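(* Let $p\in(0,1)$ and $t\ge0$. Then (a) $\mathbb{P}_p(X_t=O)=e^{-(2p-1)t}\,\mathbb{P}_{1-p}(X_t=O)$; (b) the law of the path $(X_s)_{s\in[0,t]}$ under $\mathbb{P}_p(\cdot\mid X_t=O)$ equals its law under $\mathbb{P}_{1-p}(\cdot\mid X_t=O)$.
   Context: The simple exclusion process on $\mathbb{Z}$ with parameter $p\in(0,1)$: each site is occupied by at most one particle; each particle attempts to jump one site to the right at rate $p$ and one site to the left at rate $1-p$, an attempt succeeding iff the target site is empty. $O$ is the configuration with every negative site occupied and every non-negative site empty. $\mathbb{P}_p$ is the law of the process with parameter $p$ started from $O$, $X_t$ the state at time $t$. *)

theory Defs
  imports "HOL-Probability.Probability"
begin

text \<open>Simple exclusion process on the integers, started from the step configuration O,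
constructed explicitly by the jump-hold (competing exponential clocks) construction.
A configuration is the predicate of occupied sites.  A move (x, True) is a jump of the
particle at x to x+1 (rate p), a move (x, False) a jump of the particle at x to x-1
(rate 1-p); a move is allowed iff site x is occupied and the target is empty.\<close>

type_synonym config = "int \<Rightarrow> bool"
type_synonym sep_move = "int \<times> bool"

definition O_config :: config where
  "O_config = (\<lambda>x. x < 0)"

definition target :: "sep_move \<Rightarrow> int" where
  "target m = (if snd m then fst m + 1 else fst m - 1)"

definition allowed :: "config \<Rightarrow> sep_move \<Rightarrow> bool" where
  "allowed \<eta> m \<longleftrightarrow> \<eta> (fst m) \<and> \<not> \<eta> (target m)"

definition rate :: "real \<Rightarrow> sep_move \<Rightarrow> real" where
  "rate p m = (if snd m then p else 1 - p)"

definition move :: "sep_move \<Rightarrow> config \<Rightarrow> config" where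
  "move m \<eta> = \<eta>(fst m := False, target m := True)"

text \<open>Given independent Exp(1) clocks c, the clock of move m rings at c m / rate p m;
the holding time is the first ring, and the performed move is the one that rings first.\<close>

definition hold :: "real \<Rightarrow> config \<Rightarrow> (sep_move \<Rightarrow> real) \<Rightarrow> real" where
  "hold p \<eta> c = Min {c m / rate p m | m. allowed \<eta> m}"

definition choice :: "real \<Rightarrow> config \<Rightarrow> (sep_move \<Rightarrow> real) \<Rightarrow> sep_move" where
  "choice p \<eta> c = (SOME m. allowed \<eta> m \<and> c m / rate p m = hold p \<eta> c)"

primrec jump :: "real \<Rightarrow> (nat \<times> sep_move \<Rightarrow> real) \<Rightarrow> nat \<Rightarrow> config \<times> real" where
  "jump p \<omega> 0 = (O_config, 0)"
| "jump p \<omega> (Suc n) =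
     (let \<eta> = fst (jump p \<omega> n); T = snd (jump p \<omega> n); c = (\<lambda>m. \<omega> (n, m))
      in (move (choice p \<eta> c) \<eta>, T + hold p \<eta> c))"

definition clock_space :: "(nat \<times> sep_move \<Rightarrow> real) measure" where
  "clock_space = PiM UNIV (\<lambda>_. density lborel (exponential_density 1))"

definition sep_state :: "real \<Rightarrow> real \<Rightarrow> (nat \<times> sep_move \<Rightarrow> real) \<Rightarrow> config" where
  "sep_state p t \<omega> = fst (jump p \<omega> (LEAST n. t < snd (jump p \<omega> (Suc n))))"

definition sep_path :: "real \<Rightarrow> real \<Rightarrow> (nat \<times> sep_move \<Rightarrow> real) \<Rightarrow> (real \<Rightarrow> config)" where
  "sep_path p t \<omega> = restrict (\<lambda>s. sep_state p s \<omega>) {0..t}"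

definition path_space :: "real \<Rightarrow> (real \<Rightarrow> config) measure" where
  "path_space t = PiM {0..t} (\<lambda>_. count_space UNIV)"

definition event_O :: "real \<Rightarrow> real \<Rightarrow> (nat \<times> sep_move \<Rightarrow> real) set" where
  "event_O p t = {\<omega> \<in> space clock_space. sep_state p t \<omega> = O_config}"

end

theory Submission
  imports Defs
begin

text \<open>
  Every configuration reachable from \<open>O\<close> has exactly one more descent (site from which a particle
  can jump right) than ascents, so with \<open>a\<close> ascents its total jump rate is
  \<open>p * (a + 1) + (1 - p) * a = a + p\<close>. Hence exchanging \<open>p\<close> and \<open>1 - p\<close> changes the density of a
  jump history \<open>(\<eta>\<^sub>0, T\<^sub>0), \<dots>, (\<eta>\<^sub>n, T\<^sub>n)\<close> by the factor
  \<open>(p / (1 - p)) ^ S * exp (- (2 * p - 1) * T\<^sub>n)\<close>, where \<open>S\<close>, the number of right jumps minus the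
  number of left jumps, depends only on \<open>\<eta>\<^sub>n\<close> and vanishes for \<open>\<eta>\<^sub>n = O\<close>. Taking into account
  that the process stays in \<open>O\<close> from \<open>T\<^sub>n\<close> to \<open>t\<close>, a path that is in \<open>O\<close> at time \<open>t\<close> gets
  the constant factor \<open>exp (- (2 * p - 1) * t)\<close>. There is no explosion: after \<open>n\<close> jumps the total
  rate is at most \<open>n + 1\<close>, so \<open>exp (- T\<^sub>n)\<close> has expectation at most \<open>1 / (n + 1)\<close>.
\<close>

section \<open>Configurations\<close>

text \<open>Finite perturbations of O. This set contains O, is closed under moves and is countable,
  so measurability in the configuration can be checked with the configuration frozen; and each
  member has only finitely many allowed moves.\<close>

definition configs :: "config set" where
  "configs = {\<eta>. finite {x. \<eta> x \<noteq> O_config x}}"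

definition ascents :: "config \<Rightarrow> int set" where
  "ascents \<eta> = {x. \<not> \<eta> x \<and> \<eta> (x + 1)}"

definition descents :: "config \<Rightarrow> int set" where
  "descents \<eta> = {x. \<eta> x \<and> \<not> \<eta> (x + 1)}"

text \<open>The sum of all particle positions, which diverges, minus the same sum for O: only the
  finitely many sites of disagreement contribute. Along a history from O it counts right jumps minus
  left jumps while depending on the final configuration alone.\<close>

definition displacement :: "config \<Rightarrow> int" where
  "displacement \<eta> = (\<Sum>x | \<eta> x \<noteq> O_config x. x * (of_bool (\<eta> x) - of_bool (O_config x)))"

definition total_rate :: "real \<Rightarrow> config \<Rightarrow> real" where
  "total_rate p \<eta> = (\<Sum>m | allowed \<eta> m. rate p m)"

lemma O_config_in_configs [simp]: "O_config \<in> configs"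
  by (simp add: configs_def)

lemma countable_configs: "countable configs"
proof -
  have "inj_on (\<lambda>\<eta>. {x. \<eta> x \<noteq> O_config x}) configs"
    by (rule inj_onI) (auto simp: fun_eq_iff set_eq_iff)
  moreover have "countable ((\<lambda>\<eta>. {x. \<eta> x \<noteq> O_config x}) ` configs)"
    by (rule countable_subset[OF _ countable_Collect_finite]) (auto simp: configs_def)
  ultimately show ?thesis
    by (rule countable_image_inj_on[rotated])
qed

lemma move_in_configs: "\<eta> \<in> configs \<Longrightarrow> move m \<eta> \<in> configs"
  unfolding configs_def mem_Collect_eq
  by (rule finite_subset[of _ "{x. \<eta> x \<noteq> O_config x} \<union> {fst m, target m}"])
     (auto simp: move_def)

text \<open>A left jump is indexed by its target: at an ascent \<open>x\<close> it is the particle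
  at \<open>x + 1\<close> that jumps.\<close>

lemma allowed_eq:
  "{m. allowed \<eta> m} = (\<lambda>x. (x, True)) ` descents \<eta> \<union> (\<lambda>x. (x + 1, False)) ` ascents \<eta>"
proof (rule set_eqI)
  fix m
  have "(\<exists>y. \<not> \<eta> y \<and> \<eta> (y + 1) \<and> x = y + 1) \<longleftrightarrow> \<not> \<eta> (x - 1) \<and> \<eta> x" for x :: int
    by (rule iffI, force, rule exI[of _ "x - 1"]) simp
  then show "m \<in> {m. allowed \<eta> m} \<longleftrightarrow>
      m \<in> (\<lambda>x. (x, True)) ` descents \<eta> \<union> (\<lambda>x. (x + 1, False)) ` ascents \<eta>"
    by (cases m) (auto simp: allowed_def target_def ascents_def descents_def image_iff)
qed

lemma allowed_O_config: "allowed O_config m \<longleftrightarrow> m = (-1, True)"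
  by (cases m) (auto simp: allowed_def O_config_def target_def)

lemma ascents_O_config: "ascents O_config = {}"
  by (auto simp: ascents_def O_config_def)

section \<open>Ascents, descents and the total jump rate\<close>

lemma sum_telescope_int:
  fixes f :: "int \<Rightarrow> 'a::ab_group_add"
  shows "(\<Sum>x\<in>{a..<a + int n}. f x - f (x + 1)) = f a - f (a + int n)"
proof (induction n)
  case (Suc n)
  have "{a..<a + int (Suc n)} = insert (a + int n) {a..<a + int n}"
    by auto
  with Suc show ?case
    by (simp add: algebra_simps)
qed simp

text \<open>Far to the left all sites are occupied and far to the right all are empty. Telescoping
  the occupation indicator across the line thus gives 1, while each descent contributes 1 and each
  ascent -1.\<close>

lemma
  assumes "\<eta> \<in> configs"
  shows finite_ascents: "finite (ascents \<eta>)"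
    and finite_descents: "finite (descents \<eta>)"
    and card_descents: "card (descents \<eta>) = card (ascents \<eta>) + 1"
proof -
  define D where "D = {x. \<eta> x \<noteq> O_config x}"
  have "finite D"
    using assms by (simp add: D_def configs_def)
  \<comment> \<open>Each \<bar>x\<bar> with x in \<open>D\<close> is one of the summands, and the
    extra 1 makes the bound strict and keeps \<open>N\<close> positive when \<open>D\<close> is
    empty.\<close>
  define N where "N = 1 + (\<Sum>x\<in>D. \<bar>x\<bar>)"
  have N: "\<bar>x\<bar> < N" if "x \<in> D" for x
    using member_le_sum[of x D abs] that \<open>finite D\<close> by (simp add: N_def)
  have "N > 0"
    by (simp add: N_def add_pos_nonneg sum_nonneg)
  have out: "\<eta> x \<longleftrightarrow> x < 0" if "\<bar>x\<bar> \<ge> N" for x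
    using N[of x] that by (force simp: D_def O_config_def)
  let ?I = "{-N..<-N + int (nat (2 * N))}"
  have sub: "ascents \<eta> \<subseteq> ?I" "descents \<eta> \<subseteq> ?I"
  proof -
    have "\<eta> x = \<eta> (x + 1)" if "x \<notin> ?I" for x
      using that out[of x] out[of "x + 1"] \<open>N > 0\<close> by auto
    then show "ascents \<eta> \<subseteq> ?I" "descents \<eta> \<subseteq> ?I"
      unfolding ascents_def descents_def by blast+
  qed
  show fin: "finite (ascents \<eta>)" "finite (descents \<eta>)"
    using sub finite_subset by blast+
  have "1 = of_bool (\<eta> (-N)) - (of_bool (\<eta> (-N + int (nat (2 * N)))) :: int)"
    using out[of "-N"] out[of N] \<open>N > 0\<close> by simp
  also have "\<dots> = (\<Sum>x\<in>?I. of_bool (\<eta> x) - of_bool (\<eta> (x + 1)))"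
    by (rule sum_telescope_int[symmetric])
  also have "\<dots> = (\<Sum>x\<in>?I. of_bool (x \<in> descents \<eta>) - of_bool (x \<in> ascents \<eta>))"
    by (rule sum.cong) (auto simp: ascents_def descents_def)
  also have "\<dots> = int (card (descents \<eta>)) - int (card (ascents \<eta>))"
    using sub by (simp add: sum_subtractf Int_absorb1 Int_absorb2 of_bool_def sum.If_cases Collect_mem_eq)
  finally show "card (descents \<eta>) = card (ascents \<eta>) + 1"
    by simp
qed

lemma finite_allowed: "\<eta> \<in> configs \<Longrightarrow> finite {m. allowed \<eta> m}"
  by (simp add: allowed_eq finite_ascents finite_descents)

lemma allowed_nonempty: "\<eta> \<in> configs \<Longrightarrow> {m. allowed \<eta> m} \<noteq> {}"
  using card_descents[of \<eta>] by (auto simp: allowed_eq)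

text \<open>Each descent has rate \<open>p\<close>, each ascent rate \<open>1 - p\<close>, and there
  is one more descent. The crucial consequence is that changing \<open>p\<close> to \<open>q\<close>
  shifts the total rate by \<open>p - q\<close> in every configuration alike.\<close>

lemma total_rate_eq:
  assumes "\<eta> \<in> configs"
  shows "total_rate p \<eta> = real (card (ascents \<eta>)) + p"
proof -
  have "total_rate p \<eta> = (\<Sum>m\<in>(\<lambda>x. (x, True)) ` descents \<eta>. rate p m)
      + (\<Sum>m\<in>(\<lambda>x. (x + 1, False)) ` ascents \<eta>. rate p m)"
    unfolding total_rate_def allowed_eq
    by (rule sum.union_disjoint) (auto simp: finite_ascents finite_descents assms)
  also have "(\<Sum>m\<in>(\<lambda>x. (x, True)) ` descents \<eta>. rate p m) = p * real (card (descents \<eta>))"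
    by (subst sum.reindex) (auto simp: inj_on_def rate_def)
  also have "(\<Sum>m\<in>(\<lambda>x. (x + 1, False)) ` ascents \<eta>. rate p m) = (1 - p) * real (card (ascents \<eta>))"
    by (subst sum.reindex) (auto simp: inj_on_def rate_def)
  finally show ?thesis
    using card_descents[OF assms] by (simp add: algebra_simps)
qed

text \<open>This controls the growth of the total rate. A right jump from \<open>x\<close> can
  create an ascent only at \<open>x\<close>; a left jump from \<open>x\<close> can create ascents at
  \<open>x - 2\<close> and \<open>x\<close> but destroys the one at \<open>x - 1\<close>.\<close>

lemma card_ascents_move:
  assumes "\<eta> \<in> configs" "allowed \<eta> m"
  shows "card (ascents (move m \<eta>)) \<le> card (ascents \<eta>) + 1"
proof (cases m)
  case (Pair x b)
  show ?thesis
  proof (cases b)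
    case True
    have "ascents (move m \<eta>) \<subseteq> insert x (ascents \<eta>)"
      using assms(2) unfolding Pair
      by (auto simp: ascents_def move_def target_def allowed_def True split: if_splits)
    then have "card (ascents (move m \<eta>)) \<le> card (insert x (ascents \<eta>))"
      by (rule card_mono[rotated]) (simp add: finite_ascents assms)
    also have "\<dots> \<le> card (ascents \<eta>) + 1"
      by (simp add: card_insert_if finite_ascents assms)
    finally show ?thesis .
  next
    case False
    have x: "x - 1 \<in> ascents \<eta>"
      using assms(2) unfolding Pair by (simp add: ascents_def allowed_def target_def False)
    have "y \<in> {x - 2, x} \<union> (ascents \<eta> - {x - 1})" if "y \<in> ascents (move m \<eta>)" for y
      using that assms(2) unfolding Pair
      by (auto simp: ascents_def move_def target_def allowed_def False split: if_splits)
    then have "ascents (move m \<eta>) \<subseteq> {x - 2, x} \<union> (ascents \<eta> - {x - 1})"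
      by blast
    then have "card (ascents (move m \<eta>)) \<le> card ({x - 2, x} \<union> (ascents \<eta> - {x - 1}))"
      by (rule card_mono[rotated]) (simp add: finite_ascents assms)
    also have "\<dots> \<le> card {x - 2, x} + card (ascents \<eta> - {x - 1})"
      by (rule card_Un_le)
    also have "\<dots> = 2 + (card (ascents \<eta>) - 1)"
      using x by simp
    \<comment> \<open>The truncated subtraction is exact, as \<open>x - 1\<close> shows that there
      is at least one ascent.\<close>
    also have "\<dots> \<le> card (ascents \<eta>) + 1"
      using x card_gt_0_iff[of "ascents \<eta>"] finite_ascents[OF assms(1)] by auto
    finally show ?thesis .
  qed
qed

section \<open>Displacement as the net number of right jumps\<close>

lemma displacement_O_config: "displacement O_config = 0"
  by (simp add: displacement_def)

text \<open>Allows the configurations before and after a move to be summed over the same index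
  set.\<close>

lemma displacement_superset:
  assumes "finite F" "{x. \<eta> x \<noteq> O_config x} \<subseteq> F"
  shows "displacement \<eta> = (\<Sum>x\<in>F. x * (of_bool (\<eta> x) - of_bool (O_config x)))"
  unfolding displacement_def by (rule sum.mono_neutral_left) (use assms in auto)

lemma displacement_move:
  assumes "\<eta> \<in> configs" "allowed \<eta> m"
  shows "displacement (move m \<eta>) = displacement \<eta> + (if snd m then 1 else -1)"
proof -
  define x y where "x = fst m" and "y = target m"
  have xy: "x \<noteq> y" "\<eta> x" "\<not> \<eta> y"
    using assms(2) by (auto simp: x_def y_def allowed_def target_def)
  \<comment> \<open>With both endpoints added, \<open>F\<close> contains every site of disagreement
    with O before and after the move; only the terms at \<open>x\<close> and \<open>y\<close>
    change, by -x and y.\<close>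
  define F where "F = {x. \<eta> x \<noteq> O_config x} \<union> {x, y}"
  have F: "finite F" "x \<in> F" "y \<in> F"
    using assms(1) by (auto simp: F_def configs_def)
  let ?w = "\<lambda>\<eta> z. z * (of_bool (\<eta> z) - of_bool (O_config z) :: int)"
  have "displacement (move m \<eta>) - displacement \<eta> = (\<Sum>z\<in>F. ?w (move m \<eta>) z - ?w \<eta> z)"
    unfolding sum_subtractf
    by (subst (1 2) displacement_superset[OF F(1)])
       (auto simp: F_def move_def x_def y_def)
  also have "\<dots> = (\<Sum>z\<in>{x, y}. ?w (move m \<eta>) z - ?w \<eta> z)"
    by (rule sum.mono_neutral_right) (use F in \<open>auto simp: move_def x_def y_def\<close>)
  also have "\<dots> = y - x"
    using xy by (simp add: move_def x_def[symmetric] y_def[symmetric])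
  also have "\<dots> = (if snd m then 1 else -1)"
    by (simp add: x_def y_def target_def)
  finally show ?thesis
    by simp
qed

section \<open>The clocks\<close>

abbreviation exp1 :: "real measure" where
  "exp1 \<equiv> density lborel (exponential_density 1)"

definition clock_row :: "(sep_move \<Rightarrow> real) measure" where
  "clock_row = PiM UNIV (\<lambda>_. exp1)"

interpretation exp1: prob_space exp1
  by (rule prob_space_exponential_density) simp

interpretation clock_space: prob_space clock_space
  unfolding clock_space_def by (rule prob_space_PiM) (rule exp1.prob_space_axioms)

interpretation clock_row: prob_space clock_row
  unfolding clock_row_def by (rule prob_space_PiM) (rule exp1.prob_space_axioms)

lemma space_clock_space [simp]: "space clock_space = UNIV"
  by (simp add: clock_space_def space_PiM)

lemma space_clock_row [simp]: "space clock_row = UNIV"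
  by (simp add: clock_row_def space_PiM)

lemma measurable_clock_space_component: "(\<lambda>\<omega>. \<omega> i) \<in> borel_measurable clock_space"
proof -
  have "(\<lambda>\<omega>. \<omega> i) \<in> clock_space \<rightarrow>\<^sub>M exp1"
    unfolding clock_space_def by measurable
  then show ?thesis by simp
qed

lemma measurable_clock_row_component: "(\<lambda>c. c m) \<in> borel_measurable clock_row"
proof -
  have "(\<lambda>c. c m) \<in> clock_row \<rightarrow>\<^sub>M exp1"
    unfolding clock_row_def by measurable
  then show ?thesis by simp
qed

lemma distr_clock_row_component: "distr clock_row exp1 (\<lambda>c. c m) = exp1"
  unfolding clock_row_def
  by (rule distr_PiM_component) (auto intro: exp1.prob_space_axioms)

lemma measurable_clock_row_of_space:
  "(\<lambda>\<omega> m. \<omega> (n, m)) \<in> clock_space \<rightarrow>\<^sub>M clock_row"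
  unfolding clock_row_def
  by (rule measurable_PiM_single') (auto simp: space_PiM measurable_clock_space_component)

lemma distr_clock_space_row: "distr clock_space clock_row (\<lambda>\<omega> m. \<omega> (n, m)) = clock_row"
  using distr_PiM_reindex[of UNIV "\<lambda>_::nat \<times> sep_move. exp1" "Pair n" UNIV] exp1.prob_space_axioms
  by (simp add: clock_space_def clock_row_def inj_on_def restrict_UNIV)

lemma nn_integral_clock_row_component:
  "f \<in> borel_measurable borel \<Longrightarrow> (\<integral>\<^sup>+c. f (c m) \<partial>clock_row) = (\<integral>\<^sup>+x. f x \<partial>exp1)"
  by (subst distr_clock_row_component[of m, symmetric], subst nn_integral_distr) (auto simp: measurable_clock_row_component measurable_clock_row_of_space)

lemma nn_integral_clock_space_row:
  "f \<in> borel_measurable clock_row \<Longrightarrow>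
    (\<integral>\<^sup>+\<omega>. f (\<lambda>m. \<omega> (n, m)) \<partial>clock_space) = (\<integral>\<^sup>+c. f c \<partial>clock_row)"
  by (subst distr_clock_space_row[of n, symmetric], subst nn_integral_distr) (auto simp: measurable_clock_row_component measurable_clock_row_of_space)

text \<open>Independence of the coordinates inside and outside \<open>K\<close>, in a form to which Fubini applies
  directly.\<close>

lemma measurable_resample:
  "(\<lambda>(\<omega>, \<omega>') i. if i \<in> K then \<omega>' i else \<omega> i)
    \<in> PiM UNIV (\<lambda>_. M) \<Otimes>\<^sub>M PiM UNIV (\<lambda>_. M) \<rightarrow>\<^sub>M PiM UNIV (\<lambda>_. M)"
  unfolding case_prod_beta
proof (rule measurable_PiM_single', goal_cases)
  case (1 i)
  then show ?case by (cases "i \<in> K") auto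
qed (auto simp: space_PiM space_pair_measure PiE_iff)

text \<open>A cylinder over a finite \<open>J\<close> pulls back to a rectangle: the coordinates in
  \<open>J - K\<close> are tested in the first factor, those in \<open>J \<inter> K\<close> in the
  second. Its mass therefore factorises into the product that characterises the product
  measure.\<close>

lemma distr_resample:
  fixes M :: "'a measure" and K :: "'i set"
  assumes "prob_space M"
  shows "distr (PiM UNIV (\<lambda>_. M) \<Otimes>\<^sub>M PiM UNIV (\<lambda>_. M)) (PiM UNIV (\<lambda>_. M))
      (\<lambda>(\<omega>, \<omega>') i. if i \<in> K then \<omega>' i else \<omega> i) = PiM UNIV (\<lambda>_. M)"
    (is "distr (?P \<Otimes>\<^sub>M ?P) ?P ?f = ?P")
proof -
  interpret M: prob_space M by fact
  interpret P: product_prob_space "\<lambda>_::'i. M" UNIV by standard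
  interpret PP: pair_prob_space ?P ?P ..
  show ?thesis
  proof (rule P.PiM_eq)
    fix J :: "'i set" and F assume J: "finite J" "\<And>j. j \<in> J \<Longrightarrow> F j \<in> sets M"
    have [simp]: "F j \<subseteq> space M" if "j \<in> J" for j
      using J(2)[OF that] by (rule sets.sets_into_space)
    have emb: "prod_emb UNIV (\<lambda>_. M) J (Pi\<^sub>E J F) \<in> sets ?P"
      using J by (auto intro!: sets_PiM_I)
    have "?f -` prod_emb UNIV (\<lambda>_. M) J (Pi\<^sub>E J F) \<inter> space (?P \<Otimes>\<^sub>M ?P)
       = {\<omega> \<in> space ?P. \<forall>j\<in>J - K. \<omega> j \<in> F j} \<times> {\<omega> \<in> space ?P. \<forall>j\<in>J \<inter> K. \<omega> j \<in> F j}"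
      by (auto simp: prod_emb_def space_pair_measure space_PiM PiE_iff split: if_splits)
    then have "emeasure (distr (?P \<Otimes>\<^sub>M ?P) ?P ?f) (prod_emb UNIV (\<lambda>_. M) J (Pi\<^sub>E J F))
       = emeasure (?P \<Otimes>\<^sub>M ?P) ({\<omega> \<in> space ?P. \<forall>j\<in>J - K. \<omega> j \<in> F j}
           \<times> {\<omega> \<in> space ?P. \<forall>j\<in>J \<inter> K. \<omega> j \<in> F j})"
      by (subst emeasure_distr[OF measurable_resample emb]) simp
    also have "\<dots> = emeasure ?P {\<omega> \<in> space ?P. \<forall>j\<in>J - K. \<omega> j \<in> F j}
        * emeasure ?P {\<omega> \<in> space ?P. \<forall>j\<in>J \<inter> K. \<omega> j \<in> F j}"
    proof (rule P.emeasure_pair_measure_Times)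
      have *: "{\<omega> \<in> space ?P. \<forall>j\<in>L. \<omega> j \<in> F j} \<in> sets ?P" if "L \<subseteq> J" for L
        by (intro sets.sets_Collect_finite_All sets_Collect_single J(2) finite_subset[OF that J(1)])
          (use that in auto)
      show "{\<omega> \<in> space ?P. \<forall>j\<in>J - K. \<omega> j \<in> F j} \<in> sets ?P"
        by (rule *) auto
      show "{\<omega> \<in> space ?P. \<forall>j\<in>J \<inter> K. \<omega> j \<in> F j} \<in> sets ?P"
        by (rule *) auto
    qed
    also have "\<dots> = (\<Prod>j\<in>J - K. emeasure M (F j)) * (\<Prod>j\<in>J \<inter> K. emeasure M (F j))"
      using J P.emeasure_PiM_Collect[of "J - K" F] P.emeasure_PiM_Collect[of "J \<inter> K" F] by simp
    also have "\<dots> = (\<Prod>j\<in>J. emeasure M (F j))"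
      using J(1) by (subst prod.union_disjoint[symmetric]) (auto intro!: prod.cong)
    finally show "emeasure (distr (?P \<Otimes>\<^sub>M ?P) ?P ?f) (prod_emb UNIV (\<lambda>_. M) J (Pi\<^sub>E J F))
       = (\<Prod>j\<in>J. emeasure M (F j))" .
  qed simp
qed

text \<open>Used to integrate over the coordinates in \<open>K\<close> with all others frozen: a
  single clock of a row, or a whole row of the clock array.\<close>

lemma nn_integral_resample:
  assumes M: "prob_space M" and [measurable]: "f \<in> borel_measurable (PiM UNIV (\<lambda>_. M))"
  shows "(\<integral>\<^sup>+\<omega>. f \<omega> \<partial>PiM UNIV (\<lambda>_. M))
    = (\<integral>\<^sup>+\<omega>. (\<integral>\<^sup>+\<omega>'. f (\<lambda>i. if i \<in> K then \<omega>' i else \<omega> i) \<partial>PiM UNIV (\<lambda>_. M)) \<partial>PiM UNIV (\<lambda>_. M))"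
proof -
  interpret P: prob_space "PiM UNIV (\<lambda>_. M)"
    by (rule prob_space_PiM) (rule M)
  note measurable_resample[measurable]
  have "(\<integral>\<^sup>+\<omega>. f \<omega> \<partial>PiM UNIV (\<lambda>_. M)) = (\<integral>\<^sup>+x. f ((\<lambda>(\<omega>, \<omega>') i. if i \<in> K then \<omega>' i else \<omega> i) x)
      \<partial>(PiM UNIV (\<lambda>_. M) \<Otimes>\<^sub>M PiM UNIV (\<lambda>_. M)))"
    by (subst distr_resample[OF M, of K, symmetric], subst nn_integral_distr) auto
  also have "\<dots> = (\<integral>\<^sup>+\<omega>. (\<integral>\<^sup>+\<omega>'. f (\<lambda>i. if i \<in> K then \<omega>' i else \<omega> i)
      \<partial>PiM UNIV (\<lambda>_. M)) \<partial>PiM UNIV (\<lambda>_. M))"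
    by (subst P.nn_integral_fst[symmetric]) simp_all
  finally show ?thesis .
qed

section \<open>Tails and ties of exponential clocks\<close>

lemma emeasure_exp1_greaterThan: "emeasure exp1 {a<..} = ennreal (exp (- max 0 a))"
proof -
  have "distributed exp1 lborel (\<lambda>x. x) (exponential_density 1)"
    by (auto simp: distributed_def distr_id2)
  from exp1.exponential_distributedD_gt[OF this]
  have *: "measure exp1 {a<..} = exp (- a)" if "0 \<le> a" for a
    using that by (simp add: greaterThan_def)
  \<comment> \<open>Thresholds built from clock values have no guaranteed sign pointwise, hence the
    clamp \<open>max 0 a\<close>; below zero the tail contains the half-line of positive reals, of
    full mass.\<close>
  have "measure exp1 {a<..} = 1" if "a < 0"
  proof (rule antisym)
    show "1 \<le> measure exp1 {a<..}"
      using *[of 0] exp1.finite_measure_mono[of "{0<..}" "{a<..}"] that by auto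
  qed simp
  with *[of a] show ?thesis
    by (cases "0 \<le> a") (auto simp: exp1.emeasure_eq_measure)
qed

lemma AE_exp1_neq: "AE x in exp1. x \<noteq> a"
  by (subst AE_density) (auto intro: AE_mp[OF AE_lborel_singleton[of a]])

text \<open>With all clocks but that of \<open>m\<close> frozen, a tie pins clock \<open>m\<close>
  to the single value \<open>c m' / b * a\<close>, which is a null set for the exponential
  law.\<close>

lemma AE_clock_row_no_tie:
  assumes "m \<noteq> m'" "a \<noteq> 0" "b \<noteq> 0"
  shows "AE c in clock_row. c m / a \<noteq> c m' / b"
proof -
  have [measurable]: "{c. c m / a = c m' / b} \<in> sets clock_row"
  proof -
    have "{x \<in> space M. f x / a = g x / b} \<in> sets M"
      if "f \<in> borel_measurable M" "g \<in> borel_measurable M" for M :: "'x measure" and f g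
      using that by measurable
    from this[of "\<lambda>c. c m" clock_row "\<lambda>c. c m'"] show ?thesis
      by (simp add: measurable_clock_row_component)
  qed
  have "emeasure clock_row {c. c m / a = c m' / b}
      = (\<integral>\<^sup>+c. indicator {c. c m / a = c m' / b} c \<partial>clock_row)"
    by simp
  also have "\<dots> = (\<integral>\<^sup>+c. (\<integral>\<^sup>+c'. indicator {c. c m / a = c m' / b}
      (\<lambda>i. if i \<in> {m} then c' i else c i) \<partial>clock_row) \<partial>clock_row)"
    unfolding clock_row_def
    by (rule nn_integral_resample[OF exp1.prob_space_axioms])
       (simp add: clock_row_def[symmetric])
  also have "\<dots> = (\<integral>\<^sup>+c. (\<integral>\<^sup>+c'. indicator {c m' / b * a} (c' m) \<partial>clock_row) \<partial>clock_row)"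
    using assms by (intro nn_integral_cong) (auto simp: indicator_def field_simps)
  also have "\<dots> = (\<integral>\<^sup>+c. (\<integral>\<^sup>+x. indicator {c m' / b * a} x \<partial>exp1) \<partial>clock_row)"
    by (intro nn_integral_cong nn_integral_clock_row_component) simp
  also have "\<dots> = (\<integral>\<^sup>+c. 0 \<partial>clock_row)"
    by (intro nn_integral_cong, subst nn_integral_0_iff_AE)
       (use AE_exp1_neq in \<open>auto simp: indicator_def\<close>)
  finally have "emeasure clock_row {c. c m / a = c m' / b} = 0"
    by simp
  then show ?thesis
    by (subst AE_iff_measurable[of "{c. c m / a = c m' / b}"]) auto
qed

section \<open>One step of the jump chain\<close>

lemma rate_pos: "0 < p \<Longrightarrow> p < 1 \<Longrightarrow> 0 < rate p m"
  by (simp add: rate_def)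

lemma measurable_clock_row_scaled: "(\<lambda>c. c m / a) \<in> borel_measurable clock_row"
  by (intro borel_measurable_divide measurable_clock_row_component) simp

lemma hold_eq: "hold p \<eta> c = Min ((\<lambda>m. c m / rate p m) ` {m. allowed \<eta> m})"
  unfolding hold_def by (rule arg_cong[of _ _ Min]) auto

lemma hold_le: "\<eta> \<in> configs \<Longrightarrow> allowed \<eta> m \<Longrightarrow> hold p \<eta> c \<le> c m / rate p m"
  unfolding hold_eq by (rule Min_le) (auto simp: finite_allowed)

lemma
  assumes "\<eta> \<in> configs"
  shows allowed_choice: "allowed \<eta> (choice p \<eta> c)"
    and clock_choice: "c (choice p \<eta> c) / rate p (choice p \<eta> c) = hold p \<eta> c"
proof -
  have "hold p \<eta> c \<in> (\<lambda>m. c m / rate p m) ` {m. allowed \<eta> m}"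
    unfolding hold_eq by (rule Min_in) (use assms finite_allowed allowed_nonempty in auto)
  then have "\<exists>m. allowed \<eta> m \<and> c m / rate p m = hold p \<eta> c"
    by (auto simp del: split_paired_Ex)
  from someI_ex[OF this] show "allowed \<eta> (choice p \<eta> c)"
      "c (choice p \<eta> c) / rate p (choice p \<eta> c) = hold p \<eta> c"
    by (auto simp: choice_def)
qed

lemma hold_O_config: "hold p O_config c = c (-1, True) / p"
  by (simp add: hold_eq allowed_O_config rate_def)

lemma measurable_hold: "\<eta> \<in> configs \<Longrightarrow> hold p \<eta> \<in> borel_measurable clock_row"
  unfolding hold_eq by (rule borel_measurable_Min) (simp_all add: finite_allowed measurable_clock_row_scaled)

text \<open>The arbitrary selection \<open>SOME\<close> does no harm: it depends only on the set of
  moves that attain the minimum, and this set is a measurable function with values in the finite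
  power set of the allowed moves.\<close>

lemma measurable_choice:
  assumes "\<eta> \<in> configs"
  shows "choice p \<eta> \<in> clock_row \<rightarrow>\<^sub>M count_space UNIV"
proof -
  let ?A = "{m. allowed \<eta> m}"
  let ?S = "\<lambda>c. {m. allowed \<eta> m \<and> c m / rate p m = hold p \<eta> c}"
  have fin: "finite ?A" using assms by (rule finite_allowed)
  have "countable (Pow ?A)"
    using fin by (simp add: countable_finite)
  then have "?S \<in> clock_row \<rightarrow>\<^sub>M count_space (Pow ?A)"
  proof (rule measurable_count_space_eq_countable[THEN iffD2], intro conjI ballI)
    fix S assume S: "S \<in> Pow ?A"
    then have S_iff: "?S c = S \<longleftrightarrow> (\<forall>m\<in>?A. (m \<in> S) = (c m / rate p m = hold p \<eta> c))" for c
      by blast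
    have "?S -` {S} \<inter> space clock_row
        = {c \<in> space clock_row. \<forall>m\<in>?A. (m \<in> S) = (c m / rate p m = hold p \<eta> c)}"
      unfolding vimage_def singleton_iff S_iff by blast
    also have "\<dots> \<in> sets clock_row"
    proof (rule sets.sets_Collect_finite_All[OF _ fin])
      fix m
      have "{c \<in> space clock_row. c m / rate p m = hold p \<eta> c} \<in> sets clock_row"
        by (rule borel_measurable_eq[OF measurable_clock_row_scaled measurable_hold[OF assms]])
      then show "{c \<in> space clock_row. (m \<in> S) = (c m / rate p m = hold p \<eta> c)} \<in> sets clock_row"
        by (cases "m \<in> S") (simp_all only: simp_thms sets.sets_Collect_neg)
    qed
    finally show "?S -` {S} \<inter> space clock_row \<in> sets clock_row" .
  next
    show "?S \<in> space clock_row \<rightarrow> Pow ?A"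
      by blast
  qed
  from measurable_compose[OF this, of "\<lambda>S. SOME m. m \<in> S" "count_space UNIV"] show ?thesis
    unfolding choice_def[abs_def] by simp
qed

section \<open>The joint law of the winning clock and the holding time\<close>

lemma choice_eq_iff:
  assumes "\<eta> \<in> configs" "allowed \<eta> m"
    and no_tie: "\<And>m m'. m \<noteq> m' \<Longrightarrow> allowed \<eta> m \<Longrightarrow> allowed \<eta> m' \<Longrightarrow> c m / rate p m \<noteq> c m' / rate p m'"
  shows "choice p \<eta> c = m \<longleftrightarrow>
    (\<forall>m'\<in>{m. allowed \<eta> m} - {m}. c m / rate p m < c m' / rate p m')"
proof
  assume m: "choice p \<eta> c = m"
  show "\<forall>m'\<in>{m. allowed \<eta> m} - {m}. c m / rate p m < c m' / rate p m'"
  proof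
    fix m' assume m': "m' \<in> {m. allowed \<eta> m} - {m}"
    then have "c m / rate p m \<le> c m' / rate p m'"
      using clock_choice[OF assms(1), of c p] hold_le[OF assms(1), of m' p c] m by simp
    moreover have "c m / rate p m \<noteq> c m' / rate p m'"
      using m' assms(2) by (intro no_tie) auto
    ultimately show "c m / rate p m < c m' / rate p m'"
      by simp
  qed
next
  assume less: "\<forall>m'\<in>{m. allowed \<eta> m} - {m}. c m / rate p m < c m' / rate p m'"
  show "choice p \<eta> c = m"
  proof (rule ccontr)
    assume "choice p \<eta> c \<noteq> m"
    then have "c m / rate p m < c (choice p \<eta> c) / rate p (choice p \<eta> c)"
      using less[rule_format, of "choice p \<eta> c"] allowed_choice[OF assms(1), of p c] by simp
    then have "c m / rate p m < hold p \<eta> c"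
      using clock_choice[OF assms(1), of c p] by simp
    then show False
      using hold_le[OF assms(1,2), of p c] by simp
  qed
qed

text \<open>Competing exponentials: the clock of \<open>m\<close> rings at time \<open>h\<close>
  with density \<open>rate p m * exp (- rate p m * h)\<close>, and every other allowed clock
  independently survives past \<open>h\<close> with probability
  \<open>exp (- rate p m' * h)\<close>. The exponents add up to the total rate.\<close>

lemma nn_integral_clock_wins:
  assumes p: "0 < p" "p < 1" and \<eta>: "\<eta> \<in> configs" "allowed \<eta> m"
    and [measurable]: "g \<in> borel_measurable borel"
  shows "(\<integral>\<^sup>+c. indicator {c. \<forall>m'\<in>{m. allowed \<eta> m} - {m}. c m / rate p m < c m' / rate p m'} c
            * g (c m / rate p m) \<partial>clock_row)
    = (\<integral>\<^sup>+h. ennreal (rate p m * exp (- total_rate p \<eta> * h)) * indicator {0..} h * g h \<partial>lborel)"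
proof -
  let ?A = "{m. allowed \<eta> m}" and ?r = "rate p"
  have r: "?r m > 0" for m
    using p by (rule rate_pos)
  have fin: "finite ?A" using \<eta>(1) by (rule finite_allowed)
  interpret pair_sigma_finite clock_row clock_row ..
  \<comment> \<open>The probability that all competing clocks ring after time
    \<open>h\<close>.\<close>
  define w where "w h = (\<Prod>m'\<in>?A - {m}. ennreal (exp (- max 0 (?r m' * h))))" for h
  have [measurable]: "w \<in> borel_measurable borel"
    unfolding w_def by measurable
  have w: "w h = ennreal (exp (- (\<Sum>m'\<in>?A - {m}. ?r m') * h))" if "h \<ge> 0" for h
    using that r[THEN less_imp_le] fin
    by (simp add: w_def prod_ennreal exp_sum[symmetric] sum_distrib_right sum_negf[symmetric])
  have meas: "{x \<in> space M. \<forall>m'\<in>?A - {m}. f x < f' x m'} \<in> sets M"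
    if "f \<in> borel_measurable M" "\<And>m'. (\<lambda>x. f' x m') \<in> borel_measurable M"
    for M :: "'x measure" and f :: "'x \<Rightarrow> real" and f'
    using that fin by (intro sets.sets_Collect_finite_All borel_measurable_less) auto
  have "(\<integral>\<^sup>+c. indicator {c. \<forall>m'\<in>?A - {m}. c m / ?r m < c m' / ?r m'} c * g (c m / ?r m) \<partial>clock_row)
    = (\<integral>\<^sup>+c. (\<integral>\<^sup>+c'. (\<lambda>c. indicator {c. \<forall>m'\<in>?A - {m}. c m / ?r m < c m' / ?r m'} c * g (c m / ?r m))
        (\<lambda>i. if i \<in> {m} then c' i else c i) \<partial>clock_row) \<partial>clock_row)"
    unfolding clock_row_def
  proof (rule nn_integral_resample[OF exp1.prob_space_axioms], fold clock_row_def)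
    have [measurable]: "{c. \<forall>m'\<in>?A - {m}. c m / ?r m < c m' / ?r m'} \<in> sets clock_row"
      using meas[of "\<lambda>c. c m / ?r m" clock_row "\<lambda>c m'. c m' / ?r m'"]
      by (simp add: measurable_clock_row_scaled)
    show "(\<lambda>c. indicator {c. \<forall>m'\<in>?A - {m}. c m / ?r m < c m' / ?r m'} c * g (c m / ?r m))
        \<in> borel_measurable clock_row"
      by (intro borel_measurable_times_ennreal borel_measurable_indicator
          measurable_compose[OF measurable_clock_row_scaled]) simp_all
  qed
  also have "\<dots> = (\<integral>\<^sup>+c. (\<integral>\<^sup>+c'. indicator {(c, c'). \<forall>m'\<in>?A - {m}. c' m / ?r m < c m' / ?r m'} (c, c')
        * g (c' m / ?r m) \<partial>clock_row) \<partial>clock_row)"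
    by (intro nn_integral_cong) (auto simp: indicator_def)
  \<comment> \<open>Swapping the order fixes the ring time of \<open>m\<close>, which now lives in
    \<open>c'\<close>, while the competitors in \<open>c\<close> are integrated out first.\<close>
  also have "\<dots> = (\<integral>\<^sup>+c'. (\<integral>\<^sup>+c. indicator {(c, c'). \<forall>m'\<in>?A - {m}. c' m / ?r m < c m' / ?r m'} (c, c')
        * g (c' m / ?r m) \<partial>clock_row) \<partial>clock_row)"
  proof (rule Fubini'[symmetric])
    note fst' = measurable_compose[OF measurable_fst measurable_clock_row_scaled]
    note snd' = measurable_compose[OF measurable_snd measurable_clock_row_scaled]
    have [measurable]: "{x. \<forall>m'\<in>?A - {m}. snd x m / ?r m < fst x m' / ?r m'} \<in> sets (clock_row \<Otimes>\<^sub>M clock_row)"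
      using meas[of "\<lambda>x. snd x m / ?r m" "clock_row \<Otimes>\<^sub>M clock_row" "\<lambda>x m'. fst x m' / ?r m'"]
      by (simp add: space_pair_measure fst' snd')
    have "(\<lambda>x. indicator {x. \<forall>m'\<in>?A - {m}. snd x m / ?r m < fst x m' / ?r m'} x * g (snd x m / ?r m))
        \<in> borel_measurable (clock_row \<Otimes>\<^sub>M clock_row)"
      by (intro borel_measurable_times_ennreal borel_measurable_indicator measurable_compose[OF snd']) simp_all
    then show "(\<lambda>(c, c'). indicator {(c, c'). \<forall>m'\<in>?A - {m}. c' m / ?r m < c m' / ?r m'} (c, c')
        * g (c' m / ?r m)) \<in> borel_measurable (clock_row \<Otimes>\<^sub>M clock_row)"
      by (simp add: case_prod_beta')
  qed
  also have "\<dots> = (\<integral>\<^sup>+c'. w (c' m / ?r m) * g (c' m / ?r m) \<partial>clock_row)"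
  proof (rule nn_integral_cong)
    fix c' :: "sep_move \<Rightarrow> real"
    let ?h = "c' m / ?r m"
    interpret P: product_prob_space "\<lambda>_::sep_move. exp1" UNIV ..
    have [measurable]: "{c. \<forall>m'\<in>?A - {m}. ?h < c m' / ?r m'} \<in> sets clock_row"
      using meas[of "\<lambda>c. ?h" clock_row "\<lambda>c m'. c m' / ?r m'"]
      by (simp add: measurable_clock_row_scaled)
    have "(\<integral>\<^sup>+c. indicator {(c, c'). \<forall>m'\<in>?A - {m}. c' m / ?r m < c m' / ?r m'} (c, c') * g ?h \<partial>clock_row)
        = (\<integral>\<^sup>+c. g ?h * indicator {c. \<forall>m'\<in>?A - {m}. ?h < c m' / ?r m'} c \<partial>clock_row)"
      by (intro nn_integral_cong) (auto simp: indicator_def)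
    also have "\<dots> = g ?h * emeasure clock_row {c. \<forall>m'\<in>?A - {m}. ?h < c m' / ?r m'}"
      by (rule nn_integral_cmult_indicator) simp
    also have "{c. \<forall>m'\<in>?A - {m}. ?h < c m' / ?r m'}
        = {c \<in> space clock_row. \<forall>m'\<in>?A - {m}. c m' \<in> {?r m' * ?h<..}}"
      using r by (auto simp: less_divide_eq mult.commute)
    also have "emeasure clock_row \<dots> = (\<Prod>m'\<in>?A - {m}. emeasure exp1 {?r m' * ?h<..})"
      unfolding clock_row_def by (rule P.emeasure_PiM_Collect) (use fin in auto)
    also have "\<dots> = w ?h"
      unfolding w_def emeasure_exp1_greaterThan ..
    finally show "(\<integral>\<^sup>+c. indicator {(c, c'). \<forall>m'\<in>?A - {m}. c' m / ?r m < c m' / ?r m'} (c, c') * g ?h \<partial>clock_row)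
        = w ?h * g ?h"
      by (simp add: mult.commute)
  qed
  also have "\<dots> = (\<integral>\<^sup>+x. w (x / ?r m) * g (x / ?r m) \<partial>exp1)"
    by (rule nn_integral_clock_row_component) measurable
  also have "\<dots> = (\<integral>\<^sup>+x. ennreal (exponential_density 1 x) * (w (x / ?r m) * g (x / ?r m)) \<partial>lborel)"
    by (subst nn_integral_density) auto
  \<comment> \<open>Substituting \<open>x = ?r m * h\<close> passes from the clock value to the ring
    time and produces the prefactor of the density.\<close>
  also have "\<dots> = ennreal (?r m) * (\<integral>\<^sup>+h. ennreal (exponential_density 1 (?r m * h)) * (w h * g h) \<partial>lborel)"
    using r[of m] by (subst nn_integral_real_affine[where c = "?r m" and t = 0]) auto
  also have "\<dots> = (\<integral>\<^sup>+h. ennreal (?r m) * (ennreal (exponential_density 1 (?r m * h)) * (w h * g h)) \<partial>lborel)"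
    by (rule nn_integral_cmult[symmetric]) measurable
  also have "\<dots> = (\<integral>\<^sup>+h. ennreal (?r m * exp (- total_rate p \<eta> * h)) * indicator {0..} h * g h \<partial>lborel)"
  proof (rule nn_integral_cong)
    fix h :: real
    have tot: "total_rate p \<eta> = ?r m + (\<Sum>m'\<in>?A - {m}. ?r m')"
      unfolding total_rate_def using fin \<eta>(2) by (simp add: sum.remove)
    show "ennreal (?r m) * (ennreal (exponential_density 1 (?r m * h)) * (w h * g h))
        = ennreal (?r m * exp (- total_rate p \<eta> * h)) * indicator {0..} h * g h"
    proof (cases "0 \<le> h")
      case True
      have "\<not> ?r m * h < 0"
        using True r[of m] by (simp add: not_less)
      with True have "ennreal (?r m) * (ennreal (exponential_density 1 (?r m * h)) * (w h * g h))
         = ennreal (?r m * (exp (- (?r m * h)) * exp (- (\<Sum>m'\<in>?A - {m}. ?r m') * h))) * g h"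
        using less_imp_le[OF r[of m]] by (simp add: w exponential_density_def ennreal_mult mult.assoc)
      also have "exp (- (?r m * h)) * exp (- (\<Sum>m'\<in>?A - {m}. ?r m') * h) = exp (- total_rate p \<eta> * h)"
        by (simp add: tot exp_add[symmetric] algebra_simps)
      finally show ?thesis
        using True by simp
    qed (use r[of m] in \<open>auto simp: exponential_density_def mult_less_0_iff\<close>)
  qed
  finally show ?thesis .
qed

text \<open>Off the null set of ties exactly one allowed move wins, so the integrand is the sum over
  \<open>m\<close> of its restrictions to the events that \<open>m\<close> wins.\<close>

lemma nn_integral_choice_hold:
  assumes p: "0 < p" "p < 1" and \<eta>: "\<eta> \<in> configs"
    and g: "\<And>m. g m \<in> borel_measurable borel"
  shows "(\<integral>\<^sup>+c. g (choice p \<eta> c) (hold p \<eta> c) \<partial>clock_row)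
    = (\<Sum>m | allowed \<eta> m. \<integral>\<^sup>+h. ennreal (rate p m * exp (- total_rate p \<eta> * h))
         * indicator {0..} h * g m h \<partial>lborel)"
proof -
  note [measurable] = g
  let ?A = "{m. allowed \<eta> m}" and ?r = "rate p"
  let ?W = "\<lambda>m. {c. \<forall>m'\<in>?A - {m}. c m / ?r m < c m' / ?r m'}"
  have fin: "finite ?A" using \<eta> by (rule finite_allowed)
  have W: "?W m \<in> sets clock_row" for m
  proof -
    have "{x \<in> space M. \<forall>m'\<in>?A - {m}. f m x < f m' x} \<in> sets M"
      if "\<And>m. f m \<in> borel_measurable M" for M :: "'x measure" and f :: "sep_move \<Rightarrow> 'x \<Rightarrow> real"
      using that fin by (intro sets.sets_Collect_finite_All borel_measurable_less) auto
    from this[of "\<lambda>m c. c m / ?r m" clock_row] show ?thesis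
      by (simp add: measurable_clock_row_scaled)
  qed
  have "AE c in clock_row. \<forall>m\<in>?A. \<forall>m'\<in>?A. m \<noteq> m' \<longrightarrow> c m / ?r m \<noteq> c m' / ?r m'"
    using less_imp_neq[OF rate_pos[OF p]] by (intro AE_finite_allI fin AE_impI AE_clock_row_no_tie) auto
  then have "AE c in clock_row. g (choice p \<eta> c) (hold p \<eta> c)
      = (\<Sum>m\<in>?A. indicator (?W m) c * g m (c m / ?r m))"
  proof eventually_elim
    case (elim c)
    have "indicator (?W m) c * g m (c m / ?r m)
        = (if choice p \<eta> c = m then g (choice p \<eta> c) (hold p \<eta> c) else 0)" if "m \<in> ?A" for m
      using choice_eq_iff[OF \<eta>, of m c p] clock_choice[OF \<eta>, of c p] that elim
      by (auto simp: indicator_def)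
    then have "(\<Sum>m\<in>?A. indicator (?W m) c * g m (c m / ?r m))
        = (\<Sum>m\<in>?A. if choice p \<eta> c = m then g (choice p \<eta> c) (hold p \<eta> c) else 0)"
      by (rule sum.cong[OF refl])
    also have "\<dots> = g (choice p \<eta> c) (hold p \<eta> c)"
      using fin allowed_choice[OF \<eta>, of p c] by (simp add: sum.delta)
    finally show ?case ..
  qed
  then have "(\<integral>\<^sup>+c. g (choice p \<eta> c) (hold p \<eta> c) \<partial>clock_row)
      = (\<integral>\<^sup>+c. (\<Sum>m\<in>?A. indicator (?W m) c * g m (c m / ?r m)) \<partial>clock_row)"
    by (rule nn_integral_cong_AE)
  also have "\<dots> = (\<Sum>m\<in>?A. \<integral>\<^sup>+c. indicator (?W m) c * g m (c m / ?r m) \<partial>clock_row)"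
    by (intro nn_integral_sum borel_measurable_times_ennreal borel_measurable_indicator W
        measurable_compose[OF measurable_clock_row_scaled g])
  also have "\<dots> = (\<Sum>m | allowed \<eta> m. \<integral>\<^sup>+h. ennreal (rate p m * exp (- total_rate p \<eta> * h))
         * indicator {0..} h * g m h \<partial>lborel)"
    by (intro sum.cong refl nn_integral_clock_wins p \<eta> g) auto
  finally show ?thesis .
qed

text \<open>By \<open>total_rate_eq\<close> the exponents for \<open>p\<close> and \<open>q\<close>
  differ by \<open>(p - q) * h\<close> whatever the configuration is, so the density ratio depends
  only on the move and the holding time.\<close>

lemma nn_integral_choice_hold_change_rate:
  assumes p: "0 < p" "p < 1" and q: "0 < q" "q < 1" and \<eta>: "\<eta> \<in> configs"
    and g: "\<And>m. g m \<in> borel_measurable borel"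
  shows "(\<integral>\<^sup>+c. g (choice p \<eta> c) (hold p \<eta> c) \<partial>clock_row)
    = (\<integral>\<^sup>+c. g (choice q \<eta> c) (hold q \<eta> c)
        * ennreal (rate p (choice q \<eta> c) / rate q (choice q \<eta> c) * exp (- (p - q) * hold q \<eta> c)) \<partial>clock_row)"
proof -
  note [measurable] = g
  have "(\<integral>\<^sup>+h. ennreal (rate p m * exp (- total_rate p \<eta> * h)) * indicator {0..} h * g m h \<partial>lborel)
    = (\<integral>\<^sup>+h. ennreal (rate q m * exp (- total_rate q \<eta> * h)) * indicator {0..} h
         * (g m h * ennreal (rate p m / rate q m * exp (- (p - q) * h))) \<partial>lborel)" for m
  proof (rule nn_integral_cong)
    fix h
    have "rate p m * exp (- total_rate p \<eta> * h)
        = (rate q m * exp (- total_rate q \<eta> * h)) * (rate p m / rate q m * exp (- (p - q) * h))"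
      using rate_pos[OF q, of m]
      by (simp add: total_rate_eq[OF \<eta>] exp_add[symmetric] exp_diff[symmetric] algebra_simps)
    then have "ennreal (rate p m * exp (- total_rate p \<eta> * h))
        = ennreal (rate q m * exp (- total_rate q \<eta> * h)) * ennreal (rate p m / rate q m * exp (- (p - q) * h))"
      using rate_pos[OF p, of m] rate_pos[OF q, of m] by (subst ennreal_mult[symmetric]) auto
    then show "ennreal (rate p m * exp (- total_rate p \<eta> * h)) * indicator {0..} h * g m h
      = ennreal (rate q m * exp (- total_rate q \<eta> * h)) * indicator {0..} h
         * (g m h * ennreal (rate p m / rate q m * exp (- (p - q) * h)))"
      by (simp add: ac_simps)
  qed
  then show ?thesis
    by (subst (1 2) nn_integral_choice_hold) (simp_all add: p q \<eta> g)
qed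

text \<open>The Laplace transform at 1 of an exponential holding time. Multiplying by
  \<open>exp (- h)\<close> raises the rate in the exponent by 1, which leaves a multiple of the
  exponential density of rate \<open>total_rate p \<eta> + 1\<close>.\<close>

lemma nn_integral_exp_hold:
  assumes p: "0 < p" "p < 1" and \<eta>: "\<eta> \<in> configs"
  shows "(\<integral>\<^sup>+c. ennreal (exp (- hold p \<eta> c)) \<partial>clock_row)
    = ennreal (total_rate p \<eta> / (total_rate p \<eta> + 1))"
proof -
  have pos: "total_rate p \<eta> + 1 > 0"
    using p by (simp add: total_rate_eq[OF \<eta>])
  have dens: "(\<integral>\<^sup>+h. ennreal (exponential_density (total_rate p \<eta> + 1) h) \<partial>lborel) = 1"
    using prob_space.emeasure_space_1[OF prob_space_exponential_density[OF pos]]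
    by (simp add: emeasure_density)
  have "(\<integral>\<^sup>+h. ennreal (rate p m * exp (- total_rate p \<eta> * h)) * indicator {0..} h * ennreal (exp (- h)) \<partial>lborel)
      = ennreal (rate p m / (total_rate p \<eta> + 1))" for m
  proof -
    have "(\<integral>\<^sup>+h. ennreal (rate p m * exp (- total_rate p \<eta> * h)) * indicator {0..} h * ennreal (exp (- h)) \<partial>lborel)
      = (\<integral>\<^sup>+h. ennreal (rate p m / (total_rate p \<eta> + 1)) * ennreal (exponential_density (total_rate p \<eta> + 1) h) \<partial>lborel)"
    proof (rule nn_integral_cong)
      fix h
      show "ennreal (rate p m * exp (- total_rate p \<eta> * h)) * indicator {0..} h * ennreal (exp (- h))
        = ennreal (rate p m / (total_rate p \<eta> + 1)) * ennreal (exponential_density (total_rate p \<eta> + 1) h)"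
      proof (cases "0 \<le> h")
        case True
        have eq: "rate p m * exp (- total_rate p \<eta> * h) * exp (- h)
            = rate p m / (total_rate p \<eta> + 1) * exponential_density (total_rate p \<eta> + 1) h"
          using True pos by (simp add: exponential_density_def exp_add[symmetric] distrib_left mult.commute)
        have "ennreal (rate p m * exp (- total_rate p \<eta> * h)) * indicator {0..} h * ennreal (exp (- h))
            = ennreal (rate p m * exp (- total_rate p \<eta> * h) * exp (- h))"
          using True rate_pos[OF p, of m] by (subst ennreal_mult) simp_all
        also have "\<dots> = ennreal (rate p m / (total_rate p \<eta> + 1))
            * ennreal (exponential_density (total_rate p \<eta> + 1) h)"
          unfolding eq by (rule ennreal_mult)
            (use pos rate_pos[OF p, of m] in \<open>simp_all add: exponential_density_nonneg\<close>)
        finally show ?thesis .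
      qed (simp add: exponential_density_def)
    qed
    also have "\<dots> = ennreal (rate p m / (total_rate p \<eta> + 1))"
      by (subst nn_integral_cmult) (simp_all add: dens)
    finally show ?thesis .
  qed
  then have "(\<integral>\<^sup>+c. ennreal (exp (- hold p \<eta> c)) \<partial>clock_row)
      = (\<Sum>m | allowed \<eta> m. ennreal (rate p m / (total_rate p \<eta> + 1)))"
    by (subst nn_integral_choice_hold[where g = "\<lambda>_ h. ennreal (exp (- h))"]) (simp_all add: p \<eta>)
  also have "\<dots> = ennreal (total_rate p \<eta> / (total_rate p \<eta> + 1))"
    using pos rate_pos[OF p]
    by (subst sum_ennreal) (auto simp: total_rate_def sum_divide_distrib less_imp_le)
  finally show ?thesis .
qed

section \<open>Change of the parameter for jump histories\<close>

definition step :: "real \<Rightarrow> config \<times> real \<Rightarrow> (sep_move \<Rightarrow> real) \<Rightarrow> config \<times> real" where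
  "step p x c = (move (choice p (fst x) c) (fst x), snd x + hold p (fst x) c)"

definition state_space :: "(config \<times> real) measure" where
  "state_space = count_space configs \<Otimes>\<^sub>M borel"

definition hist_space :: "(nat \<Rightarrow> config \<times> real) measure" where
  "hist_space = PiM UNIV (\<lambda>_. state_space)"

text \<open>The dummy entries beyond \<open>n\<close> make the history a function of the clock rows
  before row \<open>n\<close>, hence independent of row \<open>n\<close>, while it remains a full
  sequence to which path functionals apply.\<close>

definition hist :: "real \<Rightarrow> nat \<Rightarrow> (nat \<times> sep_move \<Rightarrow> real) \<Rightarrow> nat \<Rightarrow> config \<times> real" where
  "hist p n \<omega> = (\<lambda>i. if i \<le> n then jump p \<omega> i else (O_config, 0))"

lemma jump_Suc: "jump p \<omega> (Suc n) = step p (jump p \<omega> n) (\<lambda>m. \<omega> (n, m))"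
  by (simp add: step_def Let_def)

declare jump.simps(2) [simp del]

lemma hist_Suc:
  "hist p (Suc n) \<omega> = (hist p n \<omega>)(Suc n := step p (hist p n \<omega> n) (\<lambda>m. \<omega> (n, m)))"
  by (auto simp: hist_def jump_Suc fun_eq_iff le_Suc_eq)

section \<open>Measurability of the jump chain and its histories\<close>

lemma measurable_state_config: "fst \<in> state_space \<rightarrow>\<^sub>M count_space configs"
  unfolding state_space_def by (rule measurable_fst)

lemma measurable_state_time: "snd \<in> borel_measurable state_space"
  unfolding state_space_def by (rule measurable_snd)

lemma measurable_hist_component: "(\<lambda>y. y n) \<in> hist_space \<rightarrow>\<^sub>M state_space"
  unfolding hist_space_def by (rule measurable_component_singleton) simp

lemma measurable_hist_time: "(\<lambda>y. snd (y n)) \<in> borel_measurable hist_space"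
  by (rule measurable_compose[OF measurable_hist_component measurable_state_time])

lemma measurable_hist_config: "(\<lambda>y. fst (y n)) \<in> hist_space \<rightarrow>\<^sub>M count_space UNIV"
proof -
  have "(\<lambda>y. fst (y n)) \<in> hist_space \<rightarrow>\<^sub>M count_space configs"
    by (rule measurable_compose[OF measurable_hist_component measurable_state_config])
  from measurable_compose[OF this, of "\<lambda>\<eta>. \<eta>" "count_space UNIV"] show ?thesis
    by simp
qed

lemma measurable_hist_upd:
  assumes "f \<in> M \<rightarrow>\<^sub>M hist_space" "g \<in> M \<rightarrow>\<^sub>M state_space"
  shows "(\<lambda>x. (f x)(n := g x)) \<in> M \<rightarrow>\<^sub>M hist_space"
  using assms unfolding hist_space_def by (intro measurable_fun_upd[where J = UNIV]) auto

text \<open>The current configuration takes countably many values, so it can be frozen, which leaves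
  the measurability of \<open>choice\<close> and \<open>hold\<close> in the clocks.\<close>

lemma measurable_step:
  assumes f: "f \<in> M \<rightarrow>\<^sub>M state_space" and g: "g \<in> M \<rightarrow>\<^sub>M clock_row"
  shows "(\<lambda>x. step p (f x) (g x)) \<in> M \<rightarrow>\<^sub>M state_space"
proof -
  note config = measurable_compose[OF f measurable_state_config]
  have "(\<lambda>x. move (choice p (fst (f x)) (g x)) (fst (f x))) \<in> M \<rightarrow>\<^sub>M count_space configs"
  proof (rule measurable_compose_countable'[OF _ config countable_configs])
    fix \<eta> assume \<eta>: "\<eta> \<in> configs"
    have "(\<lambda>m. move m \<eta>) \<in> count_space UNIV \<rightarrow>\<^sub>M count_space configs"
      using move_in_configs[OF \<eta>] by simp
    from measurable_compose[OF measurable_compose[OF g measurable_choice[OF \<eta>]] this]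
    show "(\<lambda>x. move (choice p \<eta> (g x)) \<eta>) \<in> M \<rightarrow>\<^sub>M count_space configs" .
  qed
  moreover have "(\<lambda>x. hold p (fst (f x)) (g x)) \<in> borel_measurable M"
    by (rule measurable_compose_countable'[OF _ config countable_configs])
       (rule measurable_compose[OF g measurable_hold])
  ultimately show ?thesis
    unfolding step_def state_space_def
    by (intro measurable_Pair borel_measurable_add measurable_compose[OF f measurable_state_time])
qed

lemma measurable_jump: "(\<lambda>\<omega>. jump p \<omega> n) \<in> clock_space \<rightarrow>\<^sub>M state_space"
proof (induction n)
  case 0
  show ?case
    by (simp add: state_space_def space_pair_measure)
next
  case (Suc n)
  then show ?case
    unfolding jump_Suc by (intro measurable_step measurable_clock_row_of_space)
qed

lemma jump_in_configs: "fst (jump p \<omega> n) \<in> configs"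
  by (induction n) (simp_all add: jump_Suc step_def move_in_configs)

lemma card_ascents_jump: "card (ascents (fst (jump p \<omega> n))) \<le> n"
proof (induction n)
  case (Suc n)
  have "card (ascents (fst (jump p \<omega> (Suc n)))) \<le> card (ascents (fst (jump p \<omega> n))) + 1"
    unfolding jump_Suc step_def fst_conv
    by (intro card_ascents_move allowed_choice jump_in_configs)
  with Suc show ?case by simp
qed (simp add: ascents_O_config)

lemma jump_cong:
  "(\<And>k m. k < n \<Longrightarrow> \<omega> (k, m) = \<omega>' (k, m)) \<Longrightarrow> jump p \<omega> n = jump p \<omega>' n"
proof (induction n)
  case (Suc n)
  have "jump p \<omega> n = jump p \<omega>' n"
    by (rule Suc.IH) (rule Suc.prems, simp)
  moreover have "(\<lambda>m. \<omega> (n, m)) = (\<lambda>m. \<omega>' (n, m))"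
    using Suc.prems by auto
  ultimately show ?case
    by (simp only: jump_Suc)
qed simp

lemma measurable_hist: "hist p n \<in> clock_space \<rightarrow>\<^sub>M hist_space"
  unfolding hist_space_def
proof (rule measurable_PiM_single[where f = "hist p n"], goal_cases)
  case 1
  show ?case
    using jump_in_configs by (auto simp: hist_def state_space_def space_pair_measure mem_Times_iff)
next
  case (2 A i)
  have "(\<lambda>\<omega>. hist p n \<omega> i) \<in> clock_space \<rightarrow>\<^sub>M state_space"
    by (cases "i \<le> n") (simp_all add: hist_def measurable_jump, simp add: state_space_def space_pair_measure)
  then show ?case
    using 2(2) by (auto dest: measurable_sets simp: vimage_def Int_def conj_commute)
qed

text \<open>The Markov property of the construction: resampling row \<open>n\<close> leaves the
  first \<open>n\<close> jumps untouched, so the next step may be averaged with the history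
  frozen.\<close>

lemma nn_integral_hist_row:
  assumes f: "f \<in> borel_measurable (hist_space \<Otimes>\<^sub>M clock_row)"
  shows "(\<integral>\<^sup>+\<omega>. f (hist p n \<omega>, \<lambda>m. \<omega> (n, m)) \<partial>clock_space)
    = (\<integral>\<^sup>+\<omega>. (\<integral>\<^sup>+c. f (hist p n \<omega>, c) \<partial>clock_row) \<partial>clock_space)"
proof -
  let ?R = "\<lambda>\<omega> \<omega>' i. if i \<in> {n} \<times> UNIV then \<omega>' i else \<omega> i"
  have "(\<integral>\<^sup>+\<omega>. f (hist p n \<omega>, \<lambda>m. \<omega> (n, m)) \<partial>clock_space)
    = (\<integral>\<^sup>+\<omega>. (\<integral>\<^sup>+\<omega>'. f (hist p n (?R \<omega> \<omega>'), \<lambda>m. ?R \<omega> \<omega>' (n, m)) \<partial>clock_space) \<partial>clock_space)"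
    unfolding clock_space_def
  proof (rule nn_integral_resample[OF exp1.prob_space_axioms], fold clock_space_def)
    show "(\<lambda>\<omega>. f (hist p n \<omega>, \<lambda>m. \<omega> (n, m))) \<in> borel_measurable clock_space"
      by (intro measurable_compose[OF _ f] measurable_Pair measurable_hist measurable_clock_row_of_space)
  qed
  also have "\<dots> = (\<integral>\<^sup>+\<omega>. (\<integral>\<^sup>+\<omega>'. f (hist p n \<omega>, \<lambda>m. \<omega>' (n, m)) \<partial>clock_space) \<partial>clock_space)"
  proof -
    have "hist p n (?R \<omega> \<omega>') = hist p n \<omega>" for \<omega> \<omega>'
      unfolding hist_def by (intro ext if_cong refl jump_cong) auto
    then show ?thesis by simp
  qed
  also have "\<dots> = (\<integral>\<^sup>+\<omega>. (\<integral>\<^sup>+c. f (hist p n \<omega>, c) \<partial>clock_row) \<partial>clock_space)"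
  proof (rule nn_integral_cong)
    fix \<omega> assume "\<omega> \<in> space clock_space"
    then have "hist p n \<omega> \<in> space hist_space"
      by (rule measurable_space[OF measurable_hist])
    then show "(\<integral>\<^sup>+\<omega>'. f (hist p n \<omega>, \<lambda>m. \<omega>' (n, m)) \<partial>clock_space) = (\<integral>\<^sup>+c. f (hist p n \<omega>, c) \<partial>clock_row)"
      by (intro nn_integral_clock_space_row measurable_compose[OF measurable_Pair1' f])
  qed
  finally show ?thesis .
qed

text \<open>The density of the first jumps with parameter \<open>p\<close> against those with parameter \<open>1 - p\<close>: each
  right jump contributes \<open>p / (1 - p)\<close>, each left jump the inverse, and the total rates differ
  by \<open>2 * p - 1\<close>.\<close>

definition weight :: "real \<Rightarrow> config \<times> real \<Rightarrow> real" where
  "weight p x = (p / (1 - p)) powi displacement (fst x) * exp (- (2 * p - 1) * snd x)"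

lemma weight_nonneg: "0 < p \<Longrightarrow> p < 1 \<Longrightarrow> 0 \<le> weight p x"
  by (simp add: weight_def)

lemma measurable_weight: "weight p \<in> borel_measurable state_space"
proof -
  have "(\<lambda>x. (p / (1 - p)) powi displacement (fst x)) \<in> borel_measurable state_space"
    using measurable_compose[OF measurable_state_config,
        of "\<lambda>\<eta>. (p / (1 - p)) powi displacement \<eta>" borel] by simp
  moreover note [measurable] = measurable_state_time
  ultimately show ?thesis
    unfolding weight_def by measurable
qed

text \<open>The displacement changes by 1 or -1, which multiplies the power by
  \<open>p / (1 - p)\<close> or its inverse, that is by the ratio of the rates of the move. The
  exponent is kept as \<open>p - (1 - p)\<close> to match the one-step change of rate.\<close>

lemma weight_step:
  assumes p: "0 < p" "p < 1" and \<eta>: "\<eta> \<in> configs" "allowed \<eta> m"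
  shows "weight p (move m \<eta>, T + h)
    = weight p (\<eta>, T) * (rate p m / rate (1 - p) m * exp (- (p - (1 - p)) * h))"
proof -
  have "p / (1 - p) \<noteq> 0"
    using p by simp
  then have "(p / (1 - p)) powi displacement (move m \<eta>)
      = (p / (1 - p)) powi displacement \<eta> * (rate p m / rate (1 - p) m)"
    unfolding displacement_move[OF \<eta>] by (simp add: power_int_add rate_def power_int_minus)
  moreover have "exp (- (2 * p - 1) * (T + h)) = exp (- (2 * p - 1) * T) * exp (- (p - (1 - p)) * h)"
    by (simp add: exp_add[symmetric] algebra_simps)
  ultimately show ?thesis
    by (simp add: weight_def)
qed

text \<open>Induction on the number of jumps: the last step is averaged out, the hypothesis changes
  the parameter of the earlier steps, and the one-step formula then changes that of the last.
  \<open>G\<close> is kept arbitrary because the hypothesis is applied to the averaged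
  functional.\<close>

lemma nn_integral_hist_change_rate:
  assumes p: "0 < p" "p < 1" and G: "G \<in> borel_measurable hist_space"
  shows "(\<integral>\<^sup>+\<omega>. G (hist p n \<omega>) \<partial>clock_space)
    = (\<integral>\<^sup>+\<omega>. G (hist (1 - p) n \<omega>) * ennreal (weight p (hist (1 - p) n \<omega> n)) \<partial>clock_space)"
  using G
proof (induction n arbitrary: G)
  case 0
  have "hist q 0 \<omega> = (\<lambda>_. (O_config, 0))" for q \<omega>
    by (simp add: hist_def fun_eq_iff)
  then show ?case
    by (simp add: weight_def displacement_O_config)
next
  case (Suc n)
  let ?q = "1 - p"
  have q: "0 < ?q" "?q < 1"
    using p by auto
  have step: "(\<lambda>z. step r (fst z n) (snd z)) \<in> hist_space \<Otimes>\<^sub>M clock_row \<rightarrow>\<^sub>M state_space" for r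
    by (intro measurable_step measurable_compose[OF measurable_fst measurable_hist_component] measurable_snd)
  have upd: "(\<lambda>z. G ((fst z)(Suc n := step r (fst z n) (snd z)))) \<in> borel_measurable (hist_space \<Otimes>\<^sub>M clock_row)" for r
    by (intro measurable_compose[OF _ Suc.prems] measurable_hist_upd step measurable_fst)
  \<comment> \<open>The conditional expectation of \<open>G\<close> given the first \<open>n\<close>
    jumps, with the last step still run at parameter \<open>p\<close>.\<close>
  define G' where "G' y = (\<integral>\<^sup>+c. G (y(Suc n := step p (y n) c)) \<partial>clock_row)" for y
  have G': "G' \<in> borel_measurable hist_space"
    unfolding G'_def using clock_row.borel_measurable_nn_integral_fst[OF upd] by simp
  have "(\<integral>\<^sup>+\<omega>. G (hist p (Suc n) \<omega>) \<partial>clock_space) = (\<integral>\<^sup>+\<omega>. G' (hist p n \<omega>) \<partial>clock_space)"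
    unfolding hist_Suc G'_def using nn_integral_hist_row[OF upd] by simp
  also have "\<dots> = (\<integral>\<^sup>+\<omega>. G' (hist ?q n \<omega>) * ennreal (weight p (hist ?q n \<omega> n)) \<partial>clock_space)"
    by (rule Suc.IH[OF G'])
  also have "\<dots> = (\<integral>\<^sup>+\<omega>. (\<integral>\<^sup>+c. G ((hist ?q n \<omega>)(Suc n := step ?q (hist ?q n \<omega> n) c))
      * ennreal (weight p (step ?q (hist ?q n \<omega> n) c)) \<partial>clock_row) \<partial>clock_space)"
  proof (rule nn_integral_cong)
    fix \<omega> :: "nat \<times> sep_move \<Rightarrow> real"
    define y \<eta> T where "y = hist ?q n \<omega>" and "\<eta> = fst (y n)" and "T = snd (y n)"
    have yn: "y n = (\<eta>, T)"
      by (simp add: \<eta>_def T_def)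
    have y: "y \<in> space hist_space"
      unfolding y_def by (rule measurable_space[OF measurable_hist]) simp
    have \<eta>: "\<eta> \<in> configs"
      by (simp add: \<eta>_def y_def hist_def jump_in_configs)
    \<comment> \<open>The old weight is constant in the clocks of the last step; carried along in
      \<open>g\<close>, it combines with the one-step density ratio into the new weight.\<close>
    define g where "g m h = G (y(Suc n := (move m \<eta>, T + h))) * ennreal (weight p (\<eta>, T))" for m h
    have g: "g m \<in> borel_measurable borel" for m
    proof -
      have "(\<lambda>h. (move m \<eta>, T + h)) \<in> borel \<rightarrow>\<^sub>M state_space"
        unfolding state_space_def by (intro measurable_Pair) (simp_all add: move_in_configs[OF \<eta>])
      then have "(\<lambda>h. G (y(Suc n := (move m \<eta>, T + h)))) \<in> borel_measurable borel"
        using y by (intro measurable_compose[OF _ Suc.prems] measurable_hist_upd) simp_all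
      then show ?thesis
        unfolding g_def by simp
    qed
    have "G' y * ennreal (weight p (y n))
        = (\<integral>\<^sup>+c. G (y(Suc n := step p (y n) c)) * ennreal (weight p (y n)) \<partial>clock_row)"
      unfolding G'_def using measurable_compose[OF measurable_Pair1'[OF y] upd]
      by (intro nn_integral_multc[symmetric]) simp
    also have "\<dots> = (\<integral>\<^sup>+c. g (choice p \<eta> c) (hold p \<eta> c) \<partial>clock_row)"
      by (simp add: g_def yn step_def)
    also have "\<dots> = (\<integral>\<^sup>+c. g (choice ?q \<eta> c) (hold ?q \<eta> c)
        * ennreal (rate p (choice ?q \<eta> c) / rate ?q (choice ?q \<eta> c) * exp (- (p - ?q) * hold ?q \<eta> c)) \<partial>clock_row)"
      by (rule nn_integral_choice_hold_change_rate[OF p q \<eta> g])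
    also have "\<dots> = (\<integral>\<^sup>+c. G (y(Suc n := step ?q (y n) c)) * ennreal (weight p (step ?q (y n) c)) \<partial>clock_row)"
    proof (rule nn_integral_cong)
      fix c :: "sep_move \<Rightarrow> real"
      let ?m = "choice ?q \<eta> c" and ?h = "hold ?q \<eta> c"
      have st: "step ?q (y n) c = (move ?m \<eta>, T + ?h)"
        by (simp add: step_def yn)
      have "0 \<le> rate p ?m / rate ?q ?m * exp (- (p - ?q) * ?h)"
        using rate_pos[OF p, of ?m] rate_pos[OF q, of ?m] by simp
      then have "ennreal (weight p (\<eta>, T)) * ennreal (rate p ?m / rate ?q ?m * exp (- (p - ?q) * ?h))
          = ennreal (weight p (move ?m \<eta>, T + ?h))"
        unfolding weight_step[OF p \<eta> allowed_choice[OF \<eta>]]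
        by (rule ennreal_mult[symmetric, OF weight_nonneg[OF p]])
      then show "g ?m ?h * ennreal (rate p ?m / rate ?q ?m * exp (- (p - ?q) * ?h))
          = G (y(Suc n := step ?q (y n) c)) * ennreal (weight p (step ?q (y n) c))"
        unfolding g_def st by (simp only: mult.assoc)
    qed
    finally show "G' (hist ?q n \<omega>) * ennreal (weight p (hist ?q n \<omega> n))
        = (\<integral>\<^sup>+c. G ((hist ?q n \<omega>)(Suc n := step ?q (hist ?q n \<omega> n) c))
            * ennreal (weight p (step ?q (hist ?q n \<omega> n) c)) \<partial>clock_row)"
      unfolding y_def .
  qed
  also have "\<dots> = (\<integral>\<^sup>+\<omega>. G (hist ?q (Suc n) \<omega>) * ennreal (weight p (hist ?q (Suc n) \<omega> (Suc n))) \<partial>clock_space)"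
  proof -
    have "(\<lambda>z. G ((fst z)(Suc n := step ?q (fst z n) (snd z))) * ennreal (weight p (step ?q (fst z n) (snd z))))
        \<in> borel_measurable (hist_space \<Otimes>\<^sub>M clock_row)"
      by (intro borel_measurable_times_ennreal upd measurable_compose[OF _ measurable_ennreal]
          measurable_compose[OF step measurable_weight])
    from nn_integral_hist_row[OF this, of ?q n] show ?thesis
      unfolding hist_Suc by simp
  qed
  finally show ?case .
qed

section \<open>Non-explosion and the process up to a fixed time\<close>

text \<open>After \<open>n\<close> jumps the total rate is at most \<open>n + 1\<close>, so the next
  holding time contributes a factor of at most \<open>(n + 1) / (n + 2)\<close>; these factors
  telescope.\<close>

lemma nn_integral_exp_jump_time:
  assumes p: "0 < p" "p < 1"
  shows "(\<integral>\<^sup>+\<omega>. ennreal (exp (- snd (jump p \<omega> n))) \<partial>clock_space) \<le> ennreal (1 / (real n + 1))"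
proof (induction n)
  case 0
  show ?case
    using clock_space.emeasure_space_1 by simp
next
  case (Suc n)
  define L where "L \<omega> = total_rate p (fst (jump p \<omega> n))" for \<omega>
  have L: "0 \<le> L \<omega>" "L \<omega> \<le> real n + 1" for \<omega>
    using p card_ascents_jump[of p \<omega> n] by (simp_all add: L_def total_rate_eq jump_in_configs)
  have "(\<integral>\<^sup>+\<omega>. ennreal (exp (- snd (jump p \<omega> (Suc n)))) \<partial>clock_space)
      = (\<integral>\<^sup>+\<omega>. (\<lambda>z. ennreal (exp (- snd (step p (fst z n) (snd z))))) (hist p n \<omega>, \<lambda>m. \<omega> (n, m)) \<partial>clock_space)"
    by (simp add: jump_Suc hist_def)
  also have "\<dots> = (\<integral>\<^sup>+\<omega>. (\<integral>\<^sup>+c. (\<lambda>z. ennreal (exp (- snd (step p (fst z n) (snd z))))) (hist p n \<omega>, c) \<partial>clock_row) \<partial>clock_space)"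
  proof (rule nn_integral_hist_row)
    have "(\<lambda>z. snd (step p (fst z n) (snd z))) \<in> borel_measurable (hist_space \<Otimes>\<^sub>M clock_row)"
      by (intro measurable_compose[OF _ measurable_state_time] measurable_step
          measurable_compose[OF measurable_fst measurable_hist_component] measurable_snd)
    then show "(\<lambda>z. ennreal (exp (- snd (step p (fst z n) (snd z))))) \<in> borel_measurable (hist_space \<Otimes>\<^sub>M clock_row)"
      by simp
  qed
  also have "\<dots> = (\<integral>\<^sup>+\<omega>. ennreal (exp (- snd (jump p \<omega> n))) * ennreal (L \<omega> / (L \<omega> + 1)) \<partial>clock_space)"
  proof (rule nn_integral_cong)
    fix \<omega> :: "nat \<times> sep_move \<Rightarrow> real"
    let ?\<eta> = "fst (jump p \<omega> n)"
    have "(\<integral>\<^sup>+c. ennreal (exp (- snd (step p (hist p n \<omega> n) c))) \<partial>clock_row)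
       = (\<integral>\<^sup>+c. ennreal (exp (- snd (jump p \<omega> n))) * ennreal (exp (- hold p ?\<eta> c)) \<partial>clock_row)"
      by (subst ennreal_mult[symmetric]) (simp_all add: step_def hist_def exp_diff exp_minus divide_inverse)
    also have "\<dots> = ennreal (exp (- snd (jump p \<omega> n))) * (\<integral>\<^sup>+c. ennreal (exp (- hold p ?\<eta> c)) \<partial>clock_row)"
      using measurable_hold[OF jump_in_configs, of p p \<omega> n] by (intro nn_integral_cmult) simp
    also have "\<dots> = ennreal (exp (- snd (jump p \<omega> n))) * ennreal (L \<omega> / (L \<omega> + 1))"
      unfolding nn_integral_exp_hold[OF p jump_in_configs] L_def ..
    finally show "(\<integral>\<^sup>+c. (\<lambda>z. ennreal (exp (- snd (step p (fst z n) (snd z))))) (hist p n \<omega>, c) \<partial>clock_row)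
       = ennreal (exp (- snd (jump p \<omega> n))) * ennreal (L \<omega> / (L \<omega> + 1))"
      by simp
  qed
  also have "\<dots> \<le> (\<integral>\<^sup>+\<omega>. ennreal (exp (- snd (jump p \<omega> n))) * ennreal ((real n + 1) / (real n + 2)) \<partial>clock_space)"
  proof (intro nn_integral_mono mult_left_mono ennreal_leI)
    fix \<omega>
    show "L \<omega> / (L \<omega> + 1) \<le> (real n + 1) / (real n + 2)"
      using L[of \<omega>] by (simp add: field_simps)
  qed simp
  also have "\<dots> = (\<integral>\<^sup>+\<omega>. ennreal (exp (- snd (jump p \<omega> n))) \<partial>clock_space) * ennreal ((real n + 1) / (real n + 2))"
    using measurable_compose[OF measurable_jump measurable_state_time, of p n] by (intro nn_integral_multc) simp
  also have "\<dots> \<le> ennreal (1 / (real n + 1)) * ennreal ((real n + 1) / (real n + 2))"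
    by (intro mult_right_mono Suc.IH) simp
  also have "\<dots> = ennreal (1 / (real (Suc n) + 1))"
    by (subst ennreal_mult[symmetric]) (simp_all add: field_simps)
  finally show ?case .
qed

text \<open>Markov's inequality: where all jump times stay below \<open>t\<close>, each
  \<open>exp (- T)\<close> is at least \<open>exp (- t)\<close>, yet its expectation tends to 0
  along the jumps.\<close>

lemma AE_no_explosion:
  assumes p: "0 < p" "p < 1"
  shows "AE \<omega> in clock_space. \<exists>n. t < snd (jump p \<omega> (Suc n))"
proof -
  define B where "B = {\<omega> \<in> space clock_space. \<forall>n. snd (jump p \<omega> (Suc n)) \<le> t}"
  have T: "(\<lambda>\<omega>. snd (jump p \<omega> n)) \<in> borel_measurable clock_space" for n
    by (rule measurable_compose[OF measurable_jump measurable_state_time])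
  have B: "B \<in> sets clock_space"
    unfolding B_def by (intro sets.sets_Collect_countable_All borel_measurable_le T) simp
  have bound: "exp (- t) * measure clock_space B \<le> 1 / (real n + 2)" for n
  proof -
    have "ennreal (exp (- t) * measure clock_space B) = (\<integral>\<^sup>+\<omega>. ennreal (exp (- t)) * indicator B \<omega> \<partial>clock_space)"
      using B by (simp add: nn_integral_cmult_indicator clock_space.emeasure_eq_measure ennreal_mult)
    also have "\<dots> \<le> (\<integral>\<^sup>+\<omega>. ennreal (exp (- snd (jump p \<omega> (Suc n)))) \<partial>clock_space)"
      by (intro nn_integral_mono) (auto simp: B_def indicator_def)
    also have "\<dots> \<le> ennreal (1 / (real n + 2))"
      using nn_integral_exp_jump_time[OF p, of "Suc n"] by (simp add: add.commute)
    finally show ?thesis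
      by (subst (asm) ennreal_le_iff) simp_all
  qed
  have "exp (- t) * measure clock_space B < inverse (real (Suc n))" for n
    by (rule le_less_trans[OF bound[of n]]) (simp add: field_simps)
  then have "exp (- t) * measure clock_space B \<le> 0"
    by (meson reals_Archimedean not_less less_asym)
  then have "emeasure clock_space B = 0"
    by (simp add: mult_le_0_iff clock_space.emeasure_eq_measure measure_le_0_iff)
  then show ?thesis
    using B by (intro AE_I[of _ _ B]) (auto simp: B_def not_less)
qed

section \<open>Paths as deterministic functionals of jump sequences\<close>

definition path_of :: "real \<Rightarrow> (nat \<Rightarrow> config \<times> real) \<Rightarrow> real \<Rightarrow> config" where
  "path_of t y = restrict (\<lambda>s. fst (y (LEAST n. s < snd (y (Suc n))))) {0..t}"

lemma sep_path_eq: "sep_path p t \<omega> = path_of t (jump p \<omega>)"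
  by (simp add: sep_path_def sep_state_def path_of_def)

lemma sep_path_apply: "0 \<le> t \<Longrightarrow> sep_path p t \<omega> t = sep_state p t \<omega>"
  by (simp add: sep_path_def)

lemma measurable_path_of: "path_of t \<in> hist_space \<rightarrow>\<^sub>M path_space t"
  unfolding path_of_def path_space_def
proof (rule measurable_restrict)
  fix s
  have "Measurable.pred hist_space (\<lambda>y. s < snd (y (Suc n)))" for n
    using measurable_hist_time[of "Suc n"] by measurable
  then have "(\<lambda>y. LEAST n. s < snd (y (Suc n))) \<in> hist_space \<rightarrow>\<^sub>M count_space UNIV"
    by (rule measurable_Least)
  from measurable_compose_countable[OF measurable_hist_config this]
  show "(\<lambda>y. fst (y (LEAST n. s < snd (y (Suc n))))) \<in> hist_space \<rightarrow>\<^sub>M count_space UNIV" .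
qed

lemma measurable_sep_path: "sep_path p t \<in> clock_space \<rightarrow>\<^sub>M path_space t"
proof -
  have "jump p \<in> clock_space \<rightarrow>\<^sub>M hist_space"
    unfolding hist_space_def
    by (rule measurable_PiM_single'[of UNIV "\<lambda>n \<omega>. jump p \<omega> n", unfolded eta_contract_eq])
      (use jump_in_configs in \<open>auto simp: measurable_jump\<close>,
        simp add: state_space_def space_pair_measure mem_Times_iff jump_in_configs)
  from measurable_compose[OF this measurable_path_of] show ?thesis
    by (simp add: sep_path_eq[abs_def])
qed

lemma Least_eqI_upto:
  fixes P Q :: "nat \<Rightarrow> bool"
  assumes "P n" "Q n" "\<And>k. k < n \<Longrightarrow> P k = Q k"
  shows "(LEAST k. P k) = (LEAST k. Q k)"
proof (rule Least_equality)
  have le: "(LEAST k. Q k) \<le> n"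
    using assms(2) by (rule Least_le)
  show "P (LEAST k. Q k)"
    using le assms LeastI[of Q, OF assms(2)] by (cases "(LEAST k. Q k) = n") auto
  fix k assume "P k"
  then show "(LEAST k. Q k) \<le> k"
    using le assms(3) Least_le[of Q k] by (cases "k < n") auto
qed

text \<open>Only the first \<open>n\<close> jumps matter for the path up to time \<open>t\<close> if exactly \<open>n\<close> of them occur
  by then; the dummy entry at \<open>Suc n\<close> stands for the unknown later jump.\<close>

lemma sep_path_eq_hist:
  assumes "t < snd (jump p \<omega> (Suc n))"
  shows "sep_path p t \<omega> = path_of t ((hist p n \<omega>)(Suc n := (O_config, t + 1)))"
  unfolding sep_path_eq path_of_def
proof (rule restrict_ext)
  fix s assume "s \<in> {0..t}"
  let ?y = "(hist p n \<omega>)(Suc n := (O_config, t + 1))"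
  let ?k = "LEAST k. s < snd (jump p \<omega> (Suc k))"
  \<comment> \<open>Both predicates hold at index \<open>n\<close>: the true jump time exceeds
    \<open>t\<close> by assumption, and the dummy time is \<open>t + 1\<close>. Below
    \<open>n\<close> they coincide.\<close>
  have eq: "?k = (LEAST k. s < snd (?y (Suc k)))"
    by (rule Least_eqI_upto[of _ n]) (use assms \<open>s \<in> {0..t}\<close> in \<open>auto simp: hist_def\<close>)
  have "?k \<le> n"
    by (rule Least_le) (use assms \<open>s \<in> {0..t}\<close> in auto)
  then have "?y ?k = jump p \<omega> ?k"
    by (simp add: hist_def)
  then show "fst (jump p \<omega> ?k) = fst (?y (LEAST k. s < snd (?y (Suc k))))"
    unfolding eq[symmetric] by simp
qed

text \<open>The part of "exactly \<open>n\<close> jumps by time \<open>t\<close>, ending in O, path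
  in \<open>A\<close>" that is visible in the first \<open>n\<close> jumps. All \<open>n\<close>
  times are bounded, not just the last, because clock values, and with them holding times, are
  nonnegative only almost surely.\<close>

definition hist_event :: "real \<Rightarrow> nat \<Rightarrow> (real \<Rightarrow> config) set \<Rightarrow> (nat \<Rightarrow> config \<times> real) set" where
  "hist_event t n A = {y \<in> space hist_space. path_of t (y(Suc n := (O_config, t + 1))) \<in> A
     \<and> fst (y n) = O_config \<and> (\<forall>k<n. snd (y (Suc k)) \<le> t)}"

lemma sets_hist_event:
  assumes A: "A \<in> sets (path_space t)"
  shows "hist_event t n A \<in> sets hist_space"
proof -
  have "(\<lambda>y. path_of t (y(Suc n := (O_config, t + 1)))) \<in> hist_space \<rightarrow>\<^sub>M path_space t"
    by (intro measurable_compose[OF _ measurable_path_of] measurable_hist_upd)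
       (simp_all add: state_space_def space_pair_measure)
  then have 1: "{y \<in> space hist_space. path_of t (y(Suc n := (O_config, t + 1))) \<in> A} \<in> sets hist_space"
    using A by (auto dest: measurable_sets simp: vimage_def Int_def conj_commute)
  have 2: "{y \<in> space hist_space. fst (y n) = O_config} \<in> sets hist_space"
    using measurable_sets[OF measurable_hist_config, of "{O_config}" n]
    by (simp add: vimage_def Int_def conj_commute)
  have 3: "{y \<in> space hist_space. \<forall>k\<in>{..<n}. snd (y (Suc k)) \<le> t} \<in> sets hist_space"
    by (intro sets.sets_Collect_finite_All borel_measurable_le measurable_hist_time) simp_all
  have "hist_event t n A = {y \<in> space hist_space. path_of t (y(Suc n := (O_config, t + 1))) \<in> A}
      \<inter> {y \<in> space hist_space. fst (y n) = O_config}
      \<inter> {y \<in> space hist_space. \<forall>k\<in>{..<n}. snd (y (Suc k)) \<le> t}"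
    by (auto simp: hist_event_def)
  with 1 2 3 show ?thesis
    by simp
qed

definition sep_event :: "real \<Rightarrow> real \<Rightarrow> nat \<Rightarrow> (real \<Rightarrow> config) set \<Rightarrow> (nat \<times> sep_move \<Rightarrow> real) set" where
  "sep_event p t n A = {\<omega>. hist p n \<omega> \<in> hist_event t n A \<and> t < snd (jump p \<omega> (Suc n))}"

lemma sets_sep_event: "A \<in> sets (path_space t) \<Longrightarrow> sep_event p t n A \<in> sets clock_space"
proof -
  assume A: "A \<in> sets (path_space t)"
  have "hist p n -` hist_event t n A \<inter> space clock_space \<in> sets clock_space"
    by (rule measurable_sets[OF measurable_hist sets_hist_event[OF A]])
  moreover have "{\<omega> \<in> space clock_space. t < snd (jump p \<omega> (Suc n))} \<in> sets clock_space"
    by (intro borel_measurable_less measurable_compose[OF measurable_jump measurable_state_time]) simp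
  ultimately have "(hist p n -` hist_event t n A \<inter> space clock_space)
      \<inter> {\<omega> \<in> space clock_space. t < snd (jump p \<omega> (Suc n))} \<in> sets clock_space"
    by (rule sets.Int)
  then show ?thesis
    by (simp add: sep_event_def vimage_def Collect_conj_eq)
qed

lemma mem_sep_event_iff:
  "\<omega> \<in> sep_event p t n A \<longleftrightarrow> sep_path p t \<omega> \<in> A \<and> sep_state p t \<omega> = O_config
     \<and> (\<forall>k<n. snd (jump p \<omega> (Suc k)) \<le> t) \<and> t < snd (jump p \<omega> (Suc n))"
proof (cases "(\<forall>k<n. snd (jump p \<omega> (Suc k)) \<le> t) \<and> t < snd (jump p \<omega> (Suc n))")
  case True
  then have "(LEAST k. t < snd (jump p \<omega> (Suc k))) = n"
    by (intro Least_equality) (auto simp: not_less[symmetric])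
  then have "sep_state p t \<omega> = fst (jump p \<omega> n)"
    by (simp add: sep_state_def)
  moreover have "hist p n \<omega> \<in> space hist_space"
    by (rule measurable_space[OF measurable_hist]) simp
  ultimately show ?thesis
    using True sep_path_eq_hist[of t p \<omega> n] by (auto simp: sep_event_def hist_event_def hist_def)
next
  case False
  then show ?thesis
    by (auto simp: sep_event_def hist_event_def hist_def)
qed

lemma hist_event_time_le:
  assumes "hist p n \<omega> \<in> hist_event t n A" "0 \<le> t"
  shows "snd (hist p n \<omega> n) \<le> t"
  using assms by (cases n) (auto simp: hist_event_def hist_def)

text \<open>From O the only allowed move is the right jump of the particle at -1. Given the first
  \<open>n\<close> jumps, the process therefore stays in O until \<open>t\<close> if and only if
  this one clock of rate \<open>p\<close> outlasts the remaining time.\<close>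

lemma emeasure_sep_event:
  assumes p: "0 < p" "p < 1" and t: "0 \<le> t" and A: "A \<in> sets (path_space t)"
  shows "emeasure clock_space (sep_event p t n A)
    = (\<integral>\<^sup>+\<omega>. indicator (hist_event t n A) (hist p n \<omega>)
         * ennreal (exp (- p * (t - snd (hist p n \<omega> n)))) \<partial>clock_space)"
proof -
  let ?m = "(-1, True) :: sep_move"
  let ?f = "\<lambda>z. indicator (hist_event t n A) (fst z) * indicator {t<..} (snd (fst z n) + snd z ?m / p) :: ennreal"
  have "(\<lambda>z. snd (fst z n) + snd z ?m / p) \<in> borel_measurable (hist_space \<Otimes>\<^sub>M clock_row)"
    by (intro borel_measurable_add measurable_compose[OF measurable_fst measurable_hist_time]
        measurable_compose[OF measurable_snd measurable_clock_row_scaled])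
  then have f: "?f \<in> borel_measurable (hist_space \<Otimes>\<^sub>M clock_row)"
    by (intro borel_measurable_times_ennreal
        measurable_compose[OF measurable_fst borel_measurable_indicator[OF sets_hist_event[OF A]]]
        measurable_compose[OF _ borel_measurable_indicator[of "{t<..}" borel]]) simp_all
  have "emeasure clock_space (sep_event p t n A) = (\<integral>\<^sup>+\<omega>. indicator (sep_event p t n A) \<omega> \<partial>clock_space)"
    using sets_sep_event[OF A] by simp
  also have "\<dots> = (\<integral>\<^sup>+\<omega>. ?f (hist p n \<omega>, \<lambda>m. \<omega> (n, m)) \<partial>clock_space)"
  proof (rule nn_integral_cong)
    fix \<omega>
    have "snd (jump p \<omega> (Suc n)) = snd (hist p n \<omega> n) + \<omega> (n, ?m) / p" if "hist p n \<omega> \<in> hist_event t n A"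
      using that by (simp add: hist_event_def jump_Suc step_def hist_def hold_O_config)
    then show "indicator (sep_event p t n A) \<omega> = ?f (hist p n \<omega>, \<lambda>m. \<omega> (n, m))"
      by (auto simp: sep_event_def indicator_def)
  qed
  also have "\<dots> = (\<integral>\<^sup>+\<omega>. (\<integral>\<^sup>+c. ?f (hist p n \<omega>, c) \<partial>clock_row) \<partial>clock_space)"
    by (rule nn_integral_hist_row[OF f])
  also have "\<dots> = (\<integral>\<^sup>+\<omega>. indicator (hist_event t n A) (hist p n \<omega>)
         * ennreal (exp (- p * (t - snd (hist p n \<omega> n)))) \<partial>clock_space)"
  proof (rule nn_integral_cong)
    fix \<omega>
    let ?T = "snd (hist p n \<omega> n)"
    show "(\<integral>\<^sup>+c. ?f (hist p n \<omega>, c) \<partial>clock_row)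
      = indicator (hist_event t n A) (hist p n \<omega>) * ennreal (exp (- p * (t - ?T)))"
    proof (cases "hist p n \<omega> \<in> hist_event t n A")
      case True
      then have "(\<integral>\<^sup>+c. ?f (hist p n \<omega>, c) \<partial>clock_row) = (\<integral>\<^sup>+c. indicator {p * (t - ?T)<..} (c ?m) \<partial>clock_row)"
        using p by (intro nn_integral_cong) (auto simp: indicator_def field_simps)
      also have "\<dots> = (\<integral>\<^sup>+x. indicator {p * (t - ?T)<..} x \<partial>exp1)"
        by (rule nn_integral_clock_row_component) simp
      also have "\<dots> = emeasure exp1 {p * (t - ?T)<..}"
        by simp
      \<comment> \<open>Since \<open>?T\<close> is at most \<open>t\<close>, the clamp at zero in
        the tail formula disappears.\<close>
      also have "\<dots> = ennreal (exp (- p * (t - ?T)))"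
        using p hist_event_time_le[OF True t] by (simp add: emeasure_exp1_greaterThan)
      finally show ?thesis
        using True by simp
    qed simp
  qed
  finally show ?thesis .
qed

lemma emeasure_sep_event_reflect:
  assumes p: "0 < p" "p < 1" and t: "0 \<le> t" and A: "A \<in> sets (path_space t)"
  shows "emeasure clock_space (sep_event p t n A)
    = ennreal (exp (- (2 * p - 1) * t)) * emeasure clock_space (sep_event (1 - p) t n A)"
proof -
  let ?q = "1 - p"
  let ?G = "\<lambda>r y. indicator (hist_event t n A) y * ennreal (exp (- r * (t - snd (y n))))"
  have G: "?G r \<in> borel_measurable hist_space" for r
  proof -
    have "(\<lambda>y. exp (- r * (t - snd (y n)))) \<in> borel_measurable hist_space"
      by (intro measurable_compose[OF _ borel_measurable_exp] borel_measurable_times borel_measurable_diff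
          measurable_hist_time) simp_all
    then show ?thesis
      by (intro borel_measurable_times_ennreal borel_measurable_indicator sets_hist_event A
          measurable_compose[OF _ measurable_ennreal])
  qed
  have "emeasure clock_space (sep_event p t n A)
      = (\<integral>\<^sup>+\<omega>. ?G p (hist ?q n \<omega>) * ennreal (weight p (hist ?q n \<omega> n)) \<partial>clock_space)"
    unfolding emeasure_sep_event[OF p t A] by (rule nn_integral_hist_change_rate[OF p G])
  also have "\<dots> = (\<integral>\<^sup>+\<omega>. ennreal (exp (- (2 * p - 1) * t)) * ?G ?q (hist ?q n \<omega>) \<partial>clock_space)"
  proof (rule nn_integral_cong)
    fix \<omega>
    let ?y = "hist ?q n \<omega>"
    show "?G p ?y * ennreal (weight p (?y n)) = ennreal (exp (- (2 * p - 1) * t)) * ?G ?q ?y"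
    proof (cases "?y \<in> hist_event t n A")
      case True
      then have "weight p (?y n) = exp (- (2 * p - 1) * snd (?y n))"
        by (simp add: weight_def hist_event_def displacement_O_config)
      \<comment> \<open>In O the displacement vanishes, so only exponentials remain; with T the last
        jump time, both exponents equal \<open>- p * t + (1 - p) * T\<close>. The dependence on the
        history is thus exactly that of the event at parameter \<open>1 - p\<close>.\<close>
      then have "exp (- p * (t - snd (?y n))) * weight p (?y n)
          = exp (- (2 * p - 1) * t) * exp (- ?q * (t - snd (?y n)))"
        by (simp add: exp_add[symmetric] algebra_simps)
      then have "ennreal (exp (- p * (t - snd (?y n)))) * ennreal (weight p (?y n))
          = ennreal (exp (- (2 * p - 1) * t)) * ennreal (exp (- ?q * (t - snd (?y n))))"
        using weight_nonneg[OF p] by (metis ennreal_mult exp_ge_zero)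
      then show ?thesis
        using True by simp
    qed simp
  qed
  also have "\<dots> = ennreal (exp (- (2 * p - 1) * t)) * (\<integral>\<^sup>+\<omega>. ?G ?q (hist ?q n \<omega>) \<partial>clock_space)"
    by (intro nn_integral_cmult measurable_compose[OF measurable_hist G])
  also have "(\<integral>\<^sup>+\<omega>. ?G ?q (hist ?q n \<omega>) \<partial>clock_space) = emeasure clock_space (sep_event ?q t n A)"
    using p by (subst emeasure_sep_event[OF _ _ t A]) simp_all
  finally show ?thesis .
qed

section \<open>Summation over the number of jumps, and conditioning\<close>

lemma sets_event_O: "0 \<le> t \<Longrightarrow> event_O p t \<in> sets clock_space"
proof -
  assume t: "0 \<le> t"
  have "(\<lambda>f. f t) \<in> path_space t \<rightarrow>\<^sub>M count_space UNIV"
    unfolding path_space_def using t by (intro measurable_component_singleton) simp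
  from measurable_sets[OF measurable_compose[OF measurable_sep_path this], of "{O_config}" p]
  show ?thesis
    by (simp add: event_O_def vimage_def sep_path_apply t)
qed

text \<open>Outside the null set of explosion there is a first index at which the next jump time
  exceeds \<open>t\<close>, and this index selects the event that contains the outcome.\<close>

lemma emeasure_event_O_suminf:
  assumes p: "0 < p" "p < 1" and t: "0 \<le> t" and A: "A \<in> sets (path_space t)"
  shows "emeasure clock_space (event_O p t \<inter> (sep_path p t -` A \<inter> space clock_space))
    = (\<Sum>n. emeasure clock_space (sep_event p t n A))"
proof -
  have disj: "disjoint_family (\<lambda>n. sep_event p t n A)"
    unfolding disjoint_family_on_def
  proof (safe, goal_cases)
    case (1 m n \<omega>)
    then show ?case
      \<comment> \<open>With \<open>k\<close> the smaller index, one event puts jump time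
        \<open>Suc k\<close> after \<open>t\<close> and the other puts it at or before
        \<open>t\<close>.\<close>
      by (cases m n rule: linorder_cases) (auto simp: mem_sep_event_iff not_less[symmetric])
  qed
  have "emeasure clock_space (event_O p t \<inter> (sep_path p t -` A \<inter> space clock_space))
      = emeasure clock_space (\<Union>n. sep_event p t n A)"
  proof (rule emeasure_eq_AE)
    show "AE \<omega> in clock_space. \<omega> \<in> event_O p t \<inter> (sep_path p t -` A \<inter> space clock_space)
        \<longleftrightarrow> \<omega> \<in> (\<Union>n. sep_event p t n A)"
      using AE_no_explosion[OF p, of t]
    proof eventually_elim
      case (elim \<omega>)
      define n where "n = (LEAST n. t < snd (jump p \<omega> (Suc n)))"
      have "t < snd (jump p \<omega> (Suc n))"
        unfolding n_def by (rule LeastI_ex[OF elim])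
      moreover have "snd (jump p \<omega> (Suc k)) \<le> t" if "k < n" for k
        using not_less_Least[OF that[unfolded n_def]] by simp
      ultimately have "\<omega> \<in> sep_event p t n A \<longleftrightarrow> sep_path p t \<omega> \<in> A \<and> sep_state p t \<omega> = O_config"
        by (simp add: mem_sep_event_iff)
      moreover have "sep_path p t \<omega> \<in> A \<and> sep_state p t \<omega> = O_config" if "\<omega> \<in> sep_event p t k A" for k
        using that by (simp add: mem_sep_event_iff)
      ultimately show ?case
        unfolding event_O_def by auto
    qed
    show "event_O p t \<inter> (sep_path p t -` A \<inter> space clock_space) \<in> sets clock_space"
      by (intro sets.Int sets_event_O t measurable_sets[OF measurable_sep_path A])
    show "(\<Union>n. sep_event p t n A) \<in> sets clock_space"
      by (intro sets.countable_UN) (auto simp: sets_sep_event[OF A])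
  qed
  also have "\<dots> = (\<Sum>n. emeasure clock_space (sep_event p t n A))"
    by (rule suminf_emeasure[symmetric]) (use disj sets_sep_event[OF A] in auto)
  finally show ?thesis .
qed

lemma emeasure_event_O_reflect:
  assumes p: "0 < p" "p < 1" and t: "0 \<le> t" and A: "A \<in> sets (path_space t)"
  shows "emeasure clock_space (event_O p t \<inter> (sep_path p t -` A \<inter> space clock_space))
    = ennreal (exp (- (2 * p - 1) * t))
      * emeasure clock_space (event_O (1 - p) t \<inter> (sep_path (1 - p) t -` A \<inter> space clock_space))"
proof -
  have q: "0 < 1 - p" "1 - p < 1"
    using p by auto
  show ?thesis
    unfolding emeasure_event_O_suminf[OF p t A] emeasure_event_O_suminf[OF q t A]
      emeasure_sep_event_reflect[OF p t A]
    by (rule ennreal_suminf_cmult)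
qed

lemma emeasure_event_O_reflect_space:
  assumes p: "0 < p" "p < 1" and t: "0 \<le> t"
  shows "emeasure clock_space (event_O p t)
    = ennreal (exp (- (2 * p - 1) * t)) * emeasure clock_space (event_O (1 - p) t)"
proof -
  have "event_O r t \<inter> (sep_path r t -` space (path_space t) \<inter> space clock_space) = event_O r t" for r
    using measurable_space[OF measurable_sep_path[of r t]] by (auto simp: event_O_def)
  with emeasure_event_O_reflect[OF p t sets.top] show ?thesis
    by simp
qed

theorem theorem4p1:
  fixes p t :: real
  assumes "0 < p" and "p < 1" and "0 \<le> t"
  shows "measure clock_space (event_O p t)
           = exp (- (2 * p - 1) * t) * measure clock_space (event_O (1 - p) t)
       \<and> distr (uniform_measure clock_space (event_O p t)) (path_space t) (sep_path p t)
           = distr (uniform_measure clock_space (event_O (1 - p) t)) (path_space t) (sep_path (1 - p) t)"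
proof
  show "measure clock_space (event_O p t)
      = exp (- (2 * p - 1) * t) * measure clock_space (event_O (1 - p) t)"
    unfolding measure_def emeasure_event_O_reflect_space[OF assms] by (simp add: enn2real_mult)
next
  have distr: "emeasure (distr (uniform_measure clock_space (event_O r t)) (path_space t) (sep_path r t)) A
      = emeasure clock_space (event_O r t \<inter> (sep_path r t -` A \<inter> space clock_space))
        / emeasure clock_space (event_O r t)"
    if A: "A \<in> sets (path_space t)" for r A
  proof -
    have "sep_path r t \<in> uniform_measure clock_space (event_O r t) \<rightarrow>\<^sub>M path_space t"
      using measurable_sep_path by (simp add: uniform_measure_def)
    then show ?thesis
      using measurable_sets[OF measurable_sep_path A, of r] sets_event_O[OF assms(3)] A
      by (simp add: emeasure_distr)
  qed
  show "distr (uniform_measure clock_space (event_O p t)) (path_space t) (sep_path p t)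
      = distr (uniform_measure clock_space (event_O (1 - p) t)) (path_space t) (sep_path (1 - p) t)"
  proof (rule measure_eqI)
    fix A assume "A \<in> sets (distr (uniform_measure clock_space (event_O p t)) (path_space t) (sep_path p t))"
    then have A: "A \<in> sets (path_space t)"
      by simp
    show "emeasure (distr (uniform_measure clock_space (event_O p t)) (path_space t) (sep_path p t)) A
      = emeasure (distr (uniform_measure clock_space (event_O (1 - p) t)) (path_space t) (sep_path (1 - p) t)) A"
      unfolding distr[OF A] emeasure_event_O_reflect[OF assms A] emeasure_event_O_reflect_space[OF assms]
      \<comment> \<open>Numerator and denominator carry the same factor, which is positive and
        finite and so cancels in the extended nonnegative reals.\<close>
      by (simp only: mult.commute[of "ennreal (exp (- (2 * p - 1) * t))"])
         (rule divide_mult_eq, simp_all)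
  qed simp
qed

end
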